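(* Let $p\in\mathbb N$, let $(\mathbf A_n)_{n\in\mathbb N}$ be a sequence of finite base structures and $(\mathbf G_n)_{n\in\mathbb N}$ a sequence of finite gadgets such that, for every $n$ and every $S\in L$, no tuple of $S^{\mathbf G_n}$ consists only of roots of $\mathbf G_n$. Suppose that the sequence of $L_*$-structures $(\mathbf A_n*\mathbf G_n)_n$ is $\mathrm{FO}^{\mathrm{loc}}_p(L_* )$-convergent. Then for every profile $\pi=(I,E_1,\dots,E_t)$ of a $p$-tuple that is non-trivial with respect to $(\mathbf A_n*\mathbf G_n)_n$ and every local $L_R$-formula $\phi$ with $|I|+(p-|I|)\,\mathrm{ar}(R)$ free variables, the sequence $\langle\phi|_\pi,\mathbf A_n\rangle$ converges.
   Context: Fix a purely relational first-order language $L$ (with equality, finite positive arities) and a relation symbol $R\notin L$ of arity $\mathrm{ar}(R)\ge1$. All structures are finite and nonempty; $V(\mathbf A)$ is the universe of $\mathbf A$. Base structures and gadgets. $L_R=L\cup\{R\}$; a base structure is an $L_R$-structure. $L_G$ is $L$ extended by constants $z_1,\dots,z_{\mathrm{ar}(R)}$; a gadget is an $L_G$-structure $\mathbf G$ in which the vertices $z_i^{\mathbf G}$ (the roots) are pairwise distinct. Gadget construction (with construction language). $L_*=L_R\cup\{\mathrm{Int},\mathrm{Ext},\rho\}$, with $\mathrm{Int},\mathrm{Ext}$ unary and $\rho$ a relation symbol of arity $\mathrm{ar}(R)+1$. $\mathbf A*\mathbf G$ is the $L_*$-structure with universe $\big(V(\mathbf A)\sqcup(R^{\mathbf A}\times V(\mathbf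 G))\big)/\!\sim$, where $\sim$ is generated by $e_i\sim(\boldsymbol e,z_i^{\mathbf G})$ for $\boldsymbol e\in R^{\mathbf A}$, $1\le i\le\mathrm{ar}(R)$. For $S\in L$ of arity $s$, $S^{\mathbf A*\mathbf G}=\{([a_1],\dots,[a_s]):(a_1,\dots,a_s)\in S^{\mathbf A}\}\cup\{([(\boldsymbol e,v_1)],\dots,[(\boldsymbol e,v_s)]):\boldsymbol e\in R^{\mathbf A},(v_1,\dots,v_s)\in S^{\mathbf G}\}$. Moreover $R^{\mathbf A*\mathbf G}=\{([a_1],\dots,[a_{\mathrm{ar}(R)}]):(a_1,\dots,a_{\mathrm{ar}(R)})\in R^{\mathbf A}\}$; $\mathrm{Int}^{\mathbf A*\mathbf G}$ is the set of internal vertices (classes containing a vertex of $\mathbf A$); $\mathrm{Ext}^{\mathbf A*\mathbf G}$ is its complement, the set of external vertices; and $\rho^{\mathbf A*\mathbf G}=\{([(\boldsymbol e,v)],[e_1],\dots,[e_{\mathrm{ar}(R)}]):[(\boldsymbol e,v)]\in\mathrm{Ext}^{\mathbf A*\mathbf G}\}$. For an external vertex $a=[(\boldsymbol e,v)]$ write $\rho(a)=\boldsymbol e$ (uniquely determined). Locality and convergence. Distances are in the Gaifman graph. A formula is local if for some $r\in\mathbb N_0$ its satisfaction by a tuple depends only on the substructure induced by the $r$-neighborhood of the free variables. $\mathrm{FO}^{\mathrm{loc}}_p(\lambda)$ is the set of local $\lambda$-formulas with free variables among $x_1,\dots,x_p$. For $p\ge1$, $\langle\phi,\mathbf A\rangle$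 is the probability that a uniformly random $p$-tuple of vertices of $\mathbf A$ satisfies $\phi$. A sequence $(\mathbf B_n)$ is $X$-convergent if $\langle\phi,\mathbf B_n\rangle$ converges for every $\phi\in X$. Profiles. The profile of a $p$-tuple $\boldsymbol a$ from $\mathbf A*\mathbf G$ is the ordered partition $(I,E_1,\dots,E_t)$ of $\{1,\dots,p\}$ with $I=\{i:a_i\text{ internal}\}$ (possibly empty) and $E_1,\dots,E_t$ the nonempty classes of the relation $\rho(a_i)=\rho(a_{i'})$ on indices of external vertices, listed by increasing minimal element. A profile $\pi$ is trivial w.r.t. $(\mathbf A_n*\mathbf G_n)_n$ if the probability that a uniformly random $p$-tuple from $\mathbf A_n*\mathbf G_n$ has profile $\pi$ tends to $0$; otherwise it is non-trivial. For a formula $\phi(\boldsymbol x_1,\dots,\boldsymbol x_p)$ where the block $\boldsymbol x_i$ is a single variable if $i\in I$ and an $\mathrm{ar}(R)$-tuple of variables if $i\notin I$, $\langle\phi|_\pi,\mathbf A\rangle$ is the conditional probability that $\mathbf A\models\phi(\boldsymbol b_1,\dots,\boldsymbol b_p)$ for uniformly random $\boldsymbol b_1,\dots,\boldsymbol b_p$ from $\mathbf A$ (vertices, resp. $\mathrm{ar}(R)$-tuples of vertices), given that $\boldsymbol b_i\in R^{\mathbf A}$ for all $i\notin I$ and, for $i,i'\notin I$, $\boldsymbol b_i=\boldsymbol b_{i'}$ iff $i,i'$ lie in a common $E_j$. Convergence of $\langle\phi|_\pi,\mathbf A_n\rangle$ concerns all sufficiently large $n$, for which the conditioning event has positive probability.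 *)

theory Defs
  imports "HOL-Probability.Probability" "HOL-Library.NList"
begin

text \<open>A relational language is a partial map: its domain is the set of symbols,
  its values are the arities.\<close>

type_synonym 's language = "'s \<rightharpoonup> nat"

record ('s, 'v) struct =
  verts :: "'v set"
  interp :: "'s \<Rightarrow> 'v list set"

text \<open>Symbols outside the language get the empty interpretation, so that equality of
  records is equality of structures and the Gaifman graph need not mention the language.\<close>

definition fin_struct :: "'s language \<Rightarrow> ('s, 'v, 'm) struct_scheme \<Rightarrow> bool" where
  "fin_struct \<Lambda> A \<longleftrightarrow> finite (verts A) \<and> verts A \<noteq> {} \<and>
     (\<forall>S. case \<Lambda> S of
            None \<Rightarrow> interp A S = {}
          | Some k \<Rightarrow> interp A S \<subseteq> nlists k (verts A))"

definition induced :: "('s, 'v) struct \<Rightarrow> 'v set \<Rightarrow> ('s, 'v) struct" where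
  "induced A X = \<lparr>verts = verts A \<inter> X, interp = (\<lambda>S. {xs \<in> interp A S. set xs \<subseteq> X})\<rparr>"

text \<open>Variables are named by natural numbers, counted from 0: the variables
  \<open>x\<^sub>1, \<dots>, x\<^sub>p\<close> are \<open>0, \<dots>, p - 1\<close>.\<close>

datatype 's fm =
    Eq nat nat
  | Rel 's "nat list"
  | Neg "'s fm"
  | Conj "'s fm" "'s fm"
  | Exists nat "'s fm"

primrec fv :: "'s fm \<Rightarrow> nat set" where
  "fv (Eq x y) = {x, y}"
| "fv (Rel S xs) = set xs"
| "fv (Neg \<phi>) = fv \<phi>"
| "fv (Conj \<phi> \<psi>) = fv \<phi> \<union> fv \<psi>"
| "fv (Exists x \<phi>) = fv \<phi> - {x}"

primrec fm_over :: "'s language \<Rightarrow> 's fm \<Rightarrow> bool" where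
  "fm_over \<Lambda> (Eq x y) \<longleftrightarrow> True"
| "fm_over \<Lambda> (Rel S xs) \<longleftrightarrow> \<Lambda> S = Some (length xs)"
| "fm_over \<Lambda> (Neg \<phi>) \<longleftrightarrow> fm_over \<Lambda> \<phi>"
| "fm_over \<Lambda> (Conj \<phi> \<psi>) \<longleftrightarrow> fm_over \<Lambda> \<phi> \<and> fm_over \<Lambda> \<psi>"
| "fm_over \<Lambda> (Exists x \<phi>) \<longleftrightarrow> fm_over \<Lambda> \<phi>"

primrec sat :: "('s, 'v) struct \<Rightarrow> (nat \<Rightarrow> 'v) \<Rightarrow> 's fm \<Rightarrow> bool" where
  "sat A v (Eq x y) \<longleftrightarrow> v x = v y"
| "sat A v (Rel S xs) \<longleftrightarrow> map v xs \<in> interp A S"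
| "sat A v (Neg \<phi>) \<longleftrightarrow> \<not> sat A v \<phi>"
| "sat A v (Conj \<phi> \<psi>) \<longleftrightarrow> sat A v \<phi> \<and> sat A v \<psi>"
| "sat A v (Exists x \<phi>) \<longleftrightarrow> (\<exists>a\<in>verts A. sat A (v(x := a)) \<phi>)"

definition gaifman :: "('s, 'v) struct \<Rightarrow> 'v rel" where
  "gaifman A = {(a, b). a \<noteq> b \<and> (\<exists>S. \<exists>xs\<in>interp A S. a \<in> set xs \<and> b \<in> set xs)}"

definition nbhd :: "('s, 'v) struct \<Rightarrow> nat \<Rightarrow> 'v set \<Rightarrow> 'v set" where
  "nbhd A r X = {b. \<exists>a\<in>X. \<exists>k\<le>r. (a, b) \<in> gaifman A ^^ k}"

text \<open>Every finite structure has an isomorphic copy on natural numbers, so it suffices to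
  let \<open>A\<close> and \<open>B\<close> range over structures of this kind.\<close>

definition local_fm :: "'s language \<Rightarrow> 's fm \<Rightarrow> bool" where
  "local_fm \<Lambda> \<phi> \<longleftrightarrow> (\<exists>r. \<forall>(A :: ('s, nat) struct) (B :: ('s, nat) struct) v.
     fin_struct \<Lambda> A \<and> fin_struct \<Lambda> B \<and>
     v ` fv \<phi> \<subseteq> verts A \<and> v ` fv \<phi> \<subseteq> verts B \<and>
     induced A (nbhd A r (v ` fv \<phi>)) = induced B (nbhd B r (v ` fv \<phi>)) \<longrightarrow>
     (sat A v \<phi> \<longleftrightarrow> sat B v \<phi>))"

definition FO_loc :: "nat \<Rightarrow> 's language \<Rightarrow> 's fm set" where
  "FO_loc p \<Lambda> = {\<phi>. fm_over \<Lambda> \<phi> \<and> local_fm \<Lambda> \<phi> \<and> fv \<phi> \<subseteq> {..<p}}"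

definition random_tuple :: "nat \<Rightarrow> ('s, 'v) struct \<Rightarrow> 'v list pmf" where
  "random_tuple p A = pmf_of_set (nlists p (verts A))"

definition pairing :: "nat \<Rightarrow> 's fm \<Rightarrow> ('s, 'v) struct \<Rightarrow> real" where
  "pairing p \<phi> A = \<P>(as in measure_pmf (random_tuple p A). sat A ((!) as) \<phi>)"

definition FO_loc_convergent :: "nat \<Rightarrow> 's language \<Rightarrow> (nat \<Rightarrow> ('s, 'v) struct) \<Rightarrow> bool" where
  "FO_loc_convergent p \<Lambda> B \<longleftrightarrow> (\<forall>\<phi>\<in>FO_loc p \<Lambda>. convergent (\<lambda>n. pairing p \<phi> (B n)))"

datatype 's sym = Sym 's | SymR | SymInt | SymExt | SymRho

fun lang_R :: "'s language \<Rightarrow> nat \<Rightarrow> 's sym language" where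
  "lang_R L r (Sym S) = L S"
| "lang_R L r SymR = Some r"
| "lang_R L r _ = None"

definition lang_star :: "'s language \<Rightarrow> nat \<Rightarrow> 's sym language" where
  "lang_star L r = (lang_R L r)(SymInt \<mapsto> 1, SymExt \<mapsto> 1, SymRho \<mapsto> r + 1)"

record ('s, 'v) gadget = "('s, 'v) struct" +
  roots :: "'v list"

definition is_gadget :: "'s language \<Rightarrow> nat \<Rightarrow> ('s, 'v) gadget \<Rightarrow> bool" where
  "is_gadget L r G \<longleftrightarrow> fin_struct L G \<and> roots G \<in> nlists r (verts G) \<and> distinct (roots G)"

type_synonym ('a, 'g) pre_vertex = "'a + 'a list \<times> 'g"

definition glue :: "('s sym, 'a) struct \<Rightarrow> ('s, 'g) gadget \<Rightarrow> ('a, 'g) pre_vertex rel" where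
  "glue A G = {(Inl (e ! i), Inr (e, roots G ! i)) | e i.
                 e \<in> interp A SymR \<and> i < length (roots G)}"

definition cls :: "('s sym, 'a) struct \<Rightarrow> ('s, 'g) gadget \<Rightarrow>
    ('a, 'g) pre_vertex \<Rightarrow> ('a, 'g) pre_vertex set" where
  "cls A G x = (glue A G \<union> (glue A G)\<inverse>)\<^sup>* `` {x}"

definition star_verts :: "('s sym, 'a) struct \<Rightarrow> ('s, 'g) gadget \<Rightarrow>
    ('a, 'g) pre_vertex set set" where
  "star_verts A G = cls A G ` (verts A <+> (interp A SymR \<times> verts G))"

definition internal :: "('s sym, 'a) struct \<Rightarrow> ('s, 'g) gadget \<Rightarrow>
    ('a, 'g) pre_vertex set set" where
  "internal A G = {x \<in> star_verts A G. \<exists>a\<in>verts A. Inl a \<in> x}"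

definition external :: "('s sym, 'a) struct \<Rightarrow> ('s, 'g) gadget \<Rightarrow>
    ('a, 'g) pre_vertex set set" where
  "external A G = star_verts A G - internal A G"

fun star_interp :: "('s sym, 'a) struct \<Rightarrow> ('s, 'g) gadget \<Rightarrow>
    's sym \<Rightarrow> ('a, 'g) pre_vertex set list set" where
  "star_interp A G (Sym S) =
     {map (\<lambda>a. cls A G (Inl a)) as | as. as \<in> interp A (Sym S)} \<union>
     {map (\<lambda>v. cls A G (Inr (e, v))) vs | e vs. e \<in> interp A SymR \<and> vs \<in> interp G S}"
| "star_interp A G SymR = {map (\<lambda>a. cls A G (Inl a)) as | as. as \<in> interp A SymR}"
| "star_interp A G SymInt = {[x] | x. x \<in> internal A G}"
| "star_interp A G SymExt = {[x] | x. x \<in> external A G}"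
| "star_interp A G SymRho =
     {cls A G (Inr (e, v)) # map (\<lambda>a. cls A G (Inl a)) e | e v.
        e \<in> interp A SymR \<and> v \<in> verts G \<and> cls A G (Inr (e, v)) \<in> external A G}"

definition gadget_star :: "('s sym, 'a) struct \<Rightarrow> ('s, 'g) gadget \<Rightarrow>
    ('s sym, ('a, 'g) pre_vertex set) struct" where
  "gadget_star A G = \<lparr>verts = star_verts A G, interp = star_interp A G\<rparr>"

definition rho_tuple :: "('s sym, 'a) struct \<Rightarrow> ('s, 'g) gadget \<Rightarrow>
    ('a, 'g) pre_vertex set \<Rightarrow> 'a list" where
  "rho_tuple A G x = (THE e. e \<in> interp A SymR \<and> (\<exists>v\<in>verts G. x = cls A G (Inr (e, v))))"

text \<open>A profile \<open>(I, E\<^sub>1, \<dots>, E\<^sub>t)\<close> is a pair \<open>(I, [E\<^sub>1, \<dots>, E\<^sub>t])\<close>; positions in a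
  \<open>p\<close>-tuple are \<open>0, \<dots>, p - 1\<close>.\<close>

type_synonym profile = "nat set \<times> nat set list"

definition profile :: "('s sym, 'a) struct \<Rightarrow> ('s, 'g) gadget \<Rightarrow>
    ('a, 'g) pre_vertex set list \<Rightarrow> profile" where
  "profile A G as =
     (let I = {i. i < length as \<and> as ! i \<in> internal A G};
          J = {i. i < length as \<and> as ! i \<in> external A G};
          Es = (\<lambda>i. {j \<in> J. rho_tuple A G (as ! j) = rho_tuple A G (as ! i)}) ` J
      in (I, sorted_key_list_of_set Min Es))"

definition trivial_profile :: "nat \<Rightarrow> (nat \<Rightarrow> ('s sym, 'a) struct) \<Rightarrow>
    (nat \<Rightarrow> ('s, 'g) gadget) \<Rightarrow> profile \<Rightarrow> bool" where
  "trivial_profile p A G \<pi> \<longleftrightarrow>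
     (\<lambda>n. \<P>(as in measure_pmf (random_tuple p (gadget_star (A n) (G n))).
            profile (A n) (G n) as = \<pi>)) \<longlonglongrightarrow> 0"

text \<open>The random choice of the blocks \<open>b\<^sub>1, \<dots>, b\<^sub>p\<close>: a list of \<open>p\<close> lists, of length 1 at the
  positions in \<open>I\<close> and of length \<open>r\<close> at the other positions.\<close>

definition random_blocks :: "nat \<Rightarrow> nat \<Rightarrow> profile \<Rightarrow> ('s, 'a) struct \<Rightarrow> 'a list list pmf" where
  "random_blocks r p \<pi> A = pmf_of_set
     {bs. length bs = p \<and>
          (\<forall>i<p. bs ! i \<in> nlists (if i \<in> fst \<pi> then 1 else r) (verts A))}"

definition respects_profile :: "nat \<Rightarrow> profile \<Rightarrow> ('s sym, 'a) struct \<Rightarrow> 'a list list \<Rightarrow> bool" where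
  "respects_profile p \<pi> A bs \<longleftrightarrow>
     (\<forall>i<p. i \<notin> fst \<pi> \<longrightarrow> bs ! i \<in> interp A SymR) \<and>
     (\<forall>i<p. \<forall>j<p. i \<notin> fst \<pi> \<longrightarrow> j \<notin> fst \<pi> \<longrightarrow>
        (bs ! i = bs ! j \<longleftrightarrow> (\<exists>E\<in>set (snd \<pi>). i \<in> E \<and> j \<in> E)))"

definition profile_pairing :: "nat \<Rightarrow> nat \<Rightarrow> profile \<Rightarrow> 's sym fm \<Rightarrow>
    ('s sym, 'a) struct \<Rightarrow> real" where
  "profile_pairing r p \<pi> \<phi> A =
     \<P>(bs in measure_pmf (random_blocks r p \<pi> A).
        sat A ((!) (concat bs)) \<phi> \<bar> respects_profile p \<pi> A bs)"

text \<open>In HOL a conditional probability given a null event has the junk value 0; the first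
  conjunct excludes it for all sufficiently large \<open>n\<close>.\<close>

definition profile_pairing_converges :: "nat \<Rightarrow> nat \<Rightarrow> profile \<Rightarrow> 's sym fm \<Rightarrow>
    (nat \<Rightarrow> ('s sym, 'a) struct) \<Rightarrow> bool" where
  "profile_pairing_converges r p \<pi> \<phi> A \<longleftrightarrow>
     (\<forall>\<^sub>F n in sequentially.
        \<P>(bs in measure_pmf (random_blocks r p \<pi> (A n)). respects_profile p \<pi> (A n) bs) > 0) \<and>
     convergent (\<lambda>n. profile_pairing r p \<pi> \<phi> (A n))"

end

theory Submission
  imports Defs
begin

text \<open>
  Over the construction language the base structure can be recovered inside \<open>A * G\<close>: since no
  gadget tuple consists of roots only, the substructure induced by the internal vertices is
  isomorphic to \<open>A\<close>, and \<open>\<rho>\<close> sends an external vertex to its tuple in \<open>R\<close>. Hence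
  ``the tuple has profile \<open>\<pi>\<close> and \<open>\<phi>\<close> holds for the internal entries and for the \<open>\<rho>\<close>-images of
  the external ones'' is a first-order condition. It is local, because \<open>\<rho>\<close>-images are at distance
  at most 1 and relativising to the internal vertices can only increase distances.
  A choice of blocks respecting \<open>\<pi>\<close> extends to a tuple of profile \<open>\<pi>\<close> in exactly
  \<open>m\<close> to the power \<open>p - |I|\<close> ways, where \<open>m\<close> is the number of non-root vertices of the
  gadget, whatever the blocks are. So the conditional probability for \<open>A\<close> is the probability
  of the condition above divided by that of \<open>\<pi>\<close>; both converge, and the latter limit is not 0.
\<close>

section \<open>Satisfaction\<close>

lemma sat_cong: "(\<And>x. x \<in> fv \<phi> \<Longrightarrow> v x = w x) \<Longrightarrow> sat A v \<phi> \<longleftrightarrow> sat A w \<phi>"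
proof (induction \<phi> arbitrary: v w)
  case (Rel S xs)
  then have "map v xs = map w xs" by simp
  then show ?case by (simp only: sat.simps)
next
  case (Neg \<phi>)
  then show ?case by (metis fv.simps(3) sat.simps(3))
next
  case (Conj \<phi> \<psi>)
  then show ?case by (metis UnCI fv.simps(4) sat.simps(4))
next
  case (Exists x \<phi>)
  have "sat A (v(x := a)) \<phi> \<longleftrightarrow> sat A (w(x := a)) \<phi>" for a
    by (rule Exists.IH) (use Exists.prems in auto)
  then show ?case by simp
qed auto

text \<open>Injectivity is available on the vertices only. A relational atom is still reflected,
  because all tuples involved are lists of vertices, and \<open>map c\<close> is injective on those.
  The later use identifies a base structure with the internal part of its gadget
  construction.\<close>

lemma sat_isomorphic:
  assumes inj: "inj_on c (verts A)" and verts: "verts B = c ` verts A"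
    and rels: "\<And>S. interp A S \<subseteq> lists (verts A)" "\<And>S. interp B S = map c ` interp A S"
  shows "v ` fv \<phi> \<subseteq> verts A \<Longrightarrow> sat B (\<lambda>x. c (v x)) \<phi> \<longleftrightarrow> sat A v \<phi>"
proof (induction \<phi> arbitrary: v)
  case (Eq x y)
  then show ?case using inj by (auto dest: inj_onD)
next
  case (Rel S xs)
  have "inj_on (map c) (lists (verts A))"
    using inj by (rule inj_on_map_lists)
  moreover have "map v xs \<in> lists (verts A)"
    using Rel by auto
  ultimately have "map c (map v xs) \<in> map c ` interp A S \<longleftrightarrow> map v xs \<in> interp A S"
    using rels(1) by (meson inj_on_image_mem_iff)
  then show ?case by (simp add: rels(2) comp_def)
next
  case (Exists x \<phi>)
  have "sat B ((\<lambda>x. c (v x))(x := c a)) \<phi> \<longleftrightarrow> sat A (v(x := a)) \<phi>" if "a \<in> verts A" for a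
  proof -
    have "(\<lambda>y. c ((v(x := a)) y)) = (\<lambda>x. c (v x))(x := c a)" by auto
    moreover have "v(x := a) ` fv \<phi> \<subseteq> verts A"
      using Exists.prems that by auto
    ultimately show ?thesis using Exists.IH[of "v(x := a)"] by metis
  qed
  then show ?case by (auto simp: verts)
qed auto

text \<open>Turns a whole prefix of quantifiers into one choice of an assignment, so that all block
  variables can be treated at once.\<close>

lemma sat_foldr_Exists:
  "sat M v (foldr Exists xs \<phi>) \<longleftrightarrow>
     (\<exists>u. (\<forall>x. x \<notin> set xs \<longrightarrow> u x = v x) \<and> (\<forall>x\<in>set xs. u x \<in> verts M) \<and> sat M u \<phi>)"
proof (induction xs arbitrary: v)
  case Nil
  have "\<forall>x. u x = v x \<Longrightarrow> u = v" for u by auto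
  then show ?case by auto
next
  case (Cons x xs)
  show ?case
  proof
    assume "sat M v (foldr Exists (x # xs) \<phi>)"
    then obtain a u where "a \<in> verts M" "\<forall>y. y \<notin> set xs \<longrightarrow> u y = (v(x := a)) y"
      "\<forall>y\<in>set xs. u y \<in> verts M" "sat M u \<phi>"
      using Cons by auto
    then show "\<exists>u. (\<forall>y. y \<notin> set (x # xs) \<longrightarrow> u y = v y) \<and>
        (\<forall>y\<in>set (x # xs). u y \<in> verts M) \<and> sat M u \<phi>"
      by (intro exI[of _ u]) (metis fun_upd_apply set_ConsD list.set_intros)
  next
    assume "\<exists>u. (\<forall>y. y \<notin> set (x # xs) \<longrightarrow> u y = v y) \<and>
        (\<forall>y\<in>set (x # xs). u y \<in> verts M) \<and> sat M u \<phi>"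
    then obtain u where u: "\<forall>y. y \<notin> set (x # xs) \<longrightarrow> u y = v y"
      "\<forall>y\<in>set (x # xs). u y \<in> verts M" "sat M u \<phi>"
      by blast
    then have "sat M (v(x := u x)) (foldr Exists xs \<phi>)"
      by (subst Cons) (intro exI[of _ u], auto)
    with u(2) show "sat M v (foldr Exists (x # xs) \<phi>)" by auto
  qed
qed

lemma fv_foldr_Exists: "fv (foldr Exists xs \<phi>) = fv \<phi> - set xs"
  by (induction xs) auto

lemma fm_over_foldr_Exists: "fm_over \<Lambda> (foldr Exists xs \<phi>) \<longleftrightarrow> fm_over \<Lambda> \<phi>"
  by (induction xs) auto

text \<open>\<open>Eq 0 0\<close> serves as truth. It makes the variable 0 free, which is harmless
  for formulas in at least one variable.\<close>

definition conjs :: "'s fm list \<Rightarrow> 's fm" where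
  "conjs fs = foldr Conj fs (Eq 0 0)"

lemma sat_conjs: "sat M v (conjs fs) \<longleftrightarrow> (\<forall>f\<in>set fs. sat M v f)"
  by (induction fs) (auto simp: conjs_def)

lemma fv_conjs: "fv (conjs fs) = insert 0 (\<Union>f\<in>set fs. fv f)"
  by (induction fs) (auto simp: conjs_def)

lemma fm_over_conjs: "fm_over \<Lambda> (conjs fs) \<longleftrightarrow> (\<forall>f\<in>set fs. fm_over \<Lambda> f)"
  by (induction fs) (auto simp: conjs_def)

section \<open>Neighbourhoods\<close>

lemma nbhd_0: "nbhd A 0 X = X"
  by (auto simp: nbhd_def)

lemma nbhd_Suc:
  "nbhd A (Suc k) X =
     nbhd A k X \<union> {b. \<exists>S. \<exists>xs\<in>interp A S. b \<in> set xs \<and> set xs \<inter> nbhd A k X \<noteq> {}}"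
  (is "_ = ?R")
proof
  show "nbhd A (Suc k) X \<subseteq> ?R"
  proof
    fix b assume "b \<in> nbhd A (Suc k) X"
    then obtain a m where m: "a \<in> X" "m \<le> Suc k" "(a, b) \<in> gaifman A ^^ m"
      by (auto simp: nbhd_def)
    show "b \<in> ?R"
    proof (cases "m \<le> k")
      case True
      with m show ?thesis by (auto simp: nbhd_def)
    next
      case False
      with m have "m = Suc k" by simp
      with m obtain c where c: "(a, c) \<in> gaifman A ^^ k" "(c, b) \<in> gaifman A" by auto
      then have "c \<in> nbhd A k X" using m by (auto simp: nbhd_def)
      with c(2) show ?thesis by (auto simp: gaifman_def)
    qed
  qed
  show "?R \<subseteq> nbhd A (Suc k) X"
  proof
    fix b assume "b \<in> ?R"
    then consider "b \<in> nbhd A k X"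
      | S xs c where "xs \<in> interp A S" "b \<in> set xs" "c \<in> set xs" "c \<in> nbhd A k X" "b \<noteq> c"
      by auto
    then show "b \<in> nbhd A (Suc k) X"
    proof cases
      case 1
      then show ?thesis by (auto simp: nbhd_def intro: le_SucI)
    next
      case 2
      then have "(c, b) \<in> gaifman A" by (auto simp: gaifman_def)
      moreover obtain a m where "a \<in> X" "m \<le> k" "(a, c) \<in> gaifman A ^^ m"
        using 2 by (auto simp: nbhd_def)
      ultimately show ?thesis
        unfolding nbhd_def by (blast intro: relpow_Suc_I Suc_le_mono[THEN iffD2])
    qed
  qed
qed

lemma nbhd_mono: "k \<le> l \<Longrightarrow> nbhd A k X \<subseteq> nbhd A l X"
  unfolding nbhd_def by (blast intro: le_trans)

lemma subset_nbhd: "X \<subseteq> nbhd A k X"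
  using nbhd_mono[of 0 k A X] by (simp add: nbhd_0)

text \<open>Removing tuples can only lengthen distances. This bounds balls of
  \<open>int_struct M\<close> by balls of \<open>M\<close>.\<close>

lemma nbhd_subset_nbhd:
  assumes "\<And>S. interp A S \<subseteq> interp B S" "X \<subseteq> nbhd B l Y"
  shows "nbhd A k X \<subseteq> nbhd B (k + l) Y"
proof (induction k)
  case 0
  then show ?case using assms by (simp add: nbhd_0)
next
  case (Suc k)
  then show ?case using assms(1) by (auto simp: nbhd_Suc) blast
qed

lemma interp_subset_lists:
  assumes "fin_struct \<Lambda> A" "xs \<in> interp A S"
  shows "set xs \<subseteq> verts A"
  using assms unfolding fin_struct_def nlists_def by (auto split: option.splits)

lemma nbhd_subset_verts:
  assumes "fin_struct \<Lambda> A" "X \<subseteq> verts A"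
  shows "nbhd A k X \<subseteq> verts A"
proof (induction k)
  case (Suc k)
  then show ?case using interp_subset_lists[OF assms(1)] by (auto simp: nbhd_Suc)
qed (simp add: assms nbhd_0)

text \<open>A tuple meeting one ball lies entirely in the next one, hence in \<open>H\<close>, where
  both structures have the same tuples. So the two balls grow by the same vertices at each
  step.\<close>

lemma nbhd_eq_if_agree:
  assumes agree: "\<And>S xs. set xs \<subseteq> H \<Longrightarrow> xs \<in> interp A S \<longleftrightarrow> xs \<in> interp B S"
    and "nbhd A k X \<subseteq> H" "nbhd B k X \<subseteq> H"
  shows "nbhd A k X = nbhd B k X"
  using assms(2,3)
proof (induction k)
  case (Suc k)
  have IH: "nbhd A k X = nbhd B k X"
    using Suc nbhd_mono[of k "Suc k"] by (metis le_SucI order.refl order.trans)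
  have A: "set xs \<subseteq> H" if "xs \<in> interp A S" "set xs \<inter> nbhd A k X \<noteq> {}" for xs S
    using that Suc.prems(1) unfolding nbhd_Suc by blast
  have B: "set xs \<subseteq> H" if "xs \<in> interp B S" "set xs \<inter> nbhd A k X \<noteq> {}" for xs S
    using that Suc.prems(2) unfolding nbhd_Suc IH by blast
  have "xs \<in> interp A S \<longleftrightarrow> xs \<in> interp B S" if "set xs \<inter> nbhd A k X \<noteq> {}" for xs S
    using that A B agree by blast
  then show ?case unfolding nbhd_Suc IH[symmetric] by blast
qed (simp add: nbhd_0)

section \<open>The base structure inside a structure over the construction language\<close>

definition int_verts :: "('s sym, 'v) struct \<Rightarrow> 'v set" where
  "int_verts M = {x \<in> verts M. [x] \<in> interp M SymInt}"

text \<open>Defined for every structure over the construction language, because locality of the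
  profile formula must be checked on all of them and not only on those of the form
  \<open>A * G\<close>. The three additional symbols are emptied to obtain a structure over
  \<open>lang_R\<close>.\<close>

definition int_struct :: "('s sym, 'v) struct \<Rightarrow> ('s sym, 'v) struct" where
  "int_struct M = \<lparr>verts = int_verts M,
     interp = (\<lambda>S. if S \<in> {SymInt, SymExt, SymRho} then {}
                   else {xs \<in> interp M S. set xs \<subseteq> int_verts M})\<rparr>"

lemma lang_R_Some: "lang_R L r S = Some k \<Longrightarrow> S \<notin> {SymInt, SymExt, SymRho} \<and> lang_star L r S = Some k"
  by (cases S) (simp_all add: lang_star_def)

lemma lang_R_None: "lang_R L r S = None \<Longrightarrow> S \<in> {SymInt, SymExt, SymRho} \<or> lang_star L r S = None"
  by (cases S) (simp_all add: lang_star_def)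

lemma fin_struct_int_struct:
  assumes "fin_struct (lang_star L r) M" "int_verts M \<noteq> {}"
  shows "fin_struct (lang_R L r) (int_struct M)"
proof -
  have "case lang_R L r S of None \<Rightarrow> interp (int_struct M) S = {}
      | Some k \<Rightarrow> interp (int_struct M) S \<subseteq> nlists k (int_verts M)" for S
  proof -
    have M: "case lang_star L r S of None \<Rightarrow> interp M S = {}
      | Some k \<Rightarrow> interp M S \<subseteq> nlists k (verts M)"
      using assms(1) unfolding fin_struct_def by blast
    show ?thesis
    proof (cases "lang_R L r S")
      case None
      from lang_R_None[OF None] have "interp (int_struct M) S = {}"
      proof
        assume "lang_star L r S = None"
        with M have "interp M S = {}" by simp
        then show ?thesis by (simp add: int_struct_def)
      qed (simp add: int_struct_def)
      with None show ?thesis by simp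
    next
      case (Some k)
      with lang_R_Some[OF Some] M have "interp M S \<subseteq> nlists k (verts M)" by simp
      then have "interp (int_struct M) S \<subseteq> nlists k (int_verts M)"
        unfolding int_struct_def nlists_def by auto
      with Some show ?thesis by simp
    qed
  qed
  moreover have "finite (int_verts M)"
    using assms(1) unfolding fin_struct_def int_verts_def by (metis finite_Collect_conjI Collect_mem_eq)
  moreover have verts: "verts (int_struct M) = int_verts M"
    by (simp add: int_struct_def)
  ultimately show ?thesis
    using assms(2) unfolding fin_struct_def verts by blast
qed

text \<open>Bound variables are shifted along with the free ones: the shift is then one injective
  renaming, and no capture arises.\<close>

primrec relativise :: "nat \<Rightarrow> 's sym fm \<Rightarrow> 's sym fm" where
  "relativise p (Eq x y) = Eq (p + x) (p + y)"
| "relativise p (Rel S xs) = Rel S (map ((+) p) xs)"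
| "relativise p (Neg \<phi>) = Neg (relativise p \<phi>)"
| "relativise p (Conj \<phi> \<psi>) = Conj (relativise p \<phi>) (relativise p \<psi>)"
| "relativise p (Exists x \<phi>) = Exists (p + x) (Conj (Rel SymInt [p + x]) (relativise p \<phi>))"

lemma fv_relativise: "fv (relativise p \<phi>) = (+) p ` fv \<phi>"
  by (induction \<phi>) auto

lemma fm_over_relativise: "fm_over (lang_R L r) \<phi> \<Longrightarrow> fm_over (lang_star L r) (relativise p \<phi>)"
proof (induction \<phi>)
  case (Rel S xs)
  then show ?case by (cases S) (auto simp: lang_star_def)
qed (auto simp: lang_star_def)

text \<open>\<open>int_struct\<close> empties the three additional symbols, so the atoms agree only
  for formulas over \<open>lang_R\<close>, and only at internal vertices.\<close>

lemma sat_relativise: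
  assumes "fm_over (lang_R L r) \<phi>" "\<And>x. x \<in> fv \<phi> \<Longrightarrow> v (p + x) \<in> int_verts M"
  shows "sat M v (relativise p \<phi>) \<longleftrightarrow> sat (int_struct M) (\<lambda>x. v (p + x)) \<phi>"
  using assms
proof (induction \<phi> arbitrary: v)
  case (Rel S xs)
  have "S \<notin> {SymInt, SymExt, SymRho}" using Rel.prems(1) by (cases S) auto
  moreover have "set (map v (map ((+) p) xs)) \<subseteq> int_verts M" using Rel.prems(2) by auto
  ultimately show ?case by (simp add: int_struct_def comp_def)
next
  case (Exists x \<phi>)
  have "sat M (v(p + x := a)) (relativise p \<phi>) \<longleftrightarrow>
        sat (int_struct M) ((\<lambda>y. v (p + y))(x := a)) \<phi>" if "a \<in> int_verts M" for a
  proof -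
    have "(\<lambda>y. (v(p + x := a)) (p + y)) = (\<lambda>y. v (p + y))(x := a)" by auto
    moreover have "(v(p + x := a)) (p + y) \<in> int_verts M" if "y \<in> fv \<phi>" for y
      using Exists.prems(2) that \<open>a \<in> int_verts M\<close> by auto
    ultimately show ?thesis
      using Exists.IH[of "v(p + x := a)"] Exists.prems(1) by (metis fm_over.simps(5))
  qed
  then show ?case by (auto simp: int_verts_def int_struct_def)
next
  case (Conj \<phi> \<psi>)
  then show ?case by (metis UnCI fm_over.simps(4) fv.simps(4) relativise.simps(4) sat.simps(4))
qed auto

section \<open>The formula describing a profile\<close>

definition block_len :: "nat set \<Rightarrow> nat \<Rightarrow> nat \<Rightarrow> nat" where
  "block_len I r i = (if i \<in> I then 1 else r)"

definition block_off :: "nat set \<Rightarrow> nat \<Rightarrow> nat \<Rightarrow> nat" where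
  "block_off I r i = (\<Sum>j<i. block_len I r j)"

text \<open>The blocks are laid out one after the other, so that the variables of a block are its
  positions in \<open>concat bs\<close>.\<close>

definition block_vars :: "nat set \<Rightarrow> nat \<Rightarrow> nat \<Rightarrow> nat list" where
  "block_vars I r i = [block_off I r i..<block_off I r (Suc i)]"

lemma block_off_Suc: "block_off I r (Suc i) = block_off I r i + block_len I r i"
  by (simp add: block_off_def)

lemma block_off_mono: "i \<le> j \<Longrightarrow> block_off I r i \<le> block_off I r j"
  unfolding block_off_def by (rule sum_mono2) auto

lemma block_off_pos: "p \<ge> 1 \<Longrightarrow> r \<ge> 1 \<Longrightarrow> block_off I r p > 0"
  using block_off_mono[of 1 p I r] by (simp add: block_off_def block_len_def split: if_splits)

lemma length_block_vars: "length (block_vars I r i) = block_len I r i"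
  by (simp add: block_vars_def block_off_Suc)

lemma set_block_vars: "i < p \<Longrightarrow> set (block_vars I r i) \<subseteq> {..<block_off I r p}"
  using block_off_mono[of "Suc i" p I r] by (auto simp: block_vars_def)

lemma block_vars_in: "i \<in> I \<Longrightarrow> block_vars I r i = [block_off I r i]"
  by (simp add: block_vars_def block_off_Suc block_len_def)

lemma concat_block_vars: "concat (map (block_vars I r) [0..<p]) = [0..<block_off I r p]"
proof (induction p)
  case (Suc p)
  then show ?case
    using upt_add_eq_append[of 0 "block_off I r p" "block_len I r p"]
    by (simp add: block_vars_def block_off_Suc)
qed (simp add: block_off_def)

lemma block_varE:
  assumes "y < block_off I r p"
  obtains i where "i < p" "y \<in> set (block_vars I r i)"
proof -
  have "y \<in> set (concat (map (block_vars I r) [0..<p]))"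
    unfolding concat_block_vars using assms by simp
  then show ?thesis using that by auto
qed

text \<open>Bridges the running offsets and the number of free variables allowed in the theorem:
  positions in \<open>I\<close> contribute one variable each, all others \<open>r\<close>.\<close>

lemma block_off_eq:
  assumes "I \<subseteq> {..<p}"
  shows "block_off I r p = card I + (p - card I) * r"
proof -
  have "block_off I r p = (\<Sum>j\<in>I. block_len I r j) + (\<Sum>j\<in>{..<p} - I. block_len I r j)"
    unfolding block_off_def using assms by (metis add.commute finite_lessThan sum.subset_diff)
  also have "\<dots> = card I + card ({..<p} - I) * r"
    by (simp add: block_len_def)
  also have "card ({..<p} - I) = p - card I"
    using assms by (simp add: card_Diff_subset finite_subset)
  finally show ?thesis .
qed

text \<open>The induction runs from the end of the list: appending a last block changes neither the
  offsets nor the entries of the earlier ones.\<close>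

lemma nth_eq_map_concat:
  assumes "\<And>i. i < length bs \<Longrightarrow> length (bs ! i) = block_len I r i" "i < length bs"
  shows "bs ! i = map ((!) (concat bs)) (block_vars I r i)"
  using assms
proof (induction bs arbitrary: i rule: rev_induct)
  case (snoc b bs)
  have IH: "bs ! j = map ((!) (concat bs)) (block_vars I r j)" if "j < length bs" for j
    using that by (intro snoc.IH) (metis butlast_snoc length_append_singleton less_SucI nth_butlast snoc.prems(1))
  have len: "length (concat bs) = block_off I r (length bs)"
  proof -
    have "length (concat bs) = (\<Sum>j<length bs. length (bs ! j))"
      by (simp add: length_concat sum_list_sum_nth atLeast0LessThan)
    also have "\<dots> = (\<Sum>j<length bs. block_len I r j)"
    proof (rule sum.cong)
      fix j assume "j \<in> {..<length bs}"
      then show "length (bs ! j) = block_len I r j"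
        using snoc.prems(1)[of j] by (simp add: nth_append)
    qed simp
    finally show ?thesis by (simp add: block_off_def)
  qed
  show ?case
  proof (cases "i < length bs")
    case True
    then have "set (block_vars I r i) \<subseteq> {..<length (concat bs)}"
      using len set_block_vars by metis
    then have "map ((!) (concat (bs @ [b]))) (block_vars I r i) =
               map ((!) (concat bs)) (block_vars I r i)"
      by (auto simp: nth_append)
    then show ?thesis using True IH by (simp add: nth_append)
  next
    case False
    then have i: "i = length bs" using snoc.prems by simp
    then have "length b = block_len I r i" using snoc.prems(1)[of i] by simp
    then show ?thesis
      using i len by (intro nth_equalityI)
        (auto simp: block_vars_def block_off_Suc nth_append)
  qed
qed simp

text \<open>Ties the block variables to the free variable \<open>i\<close>. In \<open>A * G\<close>
  the \<rho>-atom does two jobs: it forces entry \<open>i\<close> to be external and it names its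
  tuple in \<open>R\<close>.\<close>

definition block_fm :: "nat set \<Rightarrow> nat \<Rightarrow> nat \<Rightarrow> nat \<Rightarrow> 's sym fm" where
  "block_fm I r p i =
     (if i \<in> I then Eq i (p + block_off I r i)
      else Rel SymRho (i # map ((+) p) (block_vars I r i)))"

definition same_block_fm :: "nat set \<Rightarrow> nat \<Rightarrow> nat \<Rightarrow> nat \<Rightarrow> nat \<Rightarrow> 's sym fm" where
  "same_block_fm I r p i j =
     conjs (map (\<lambda>k. Eq (p + (block_off I r i + k)) (p + (block_off I r j + k))) [0..<r])"

text \<open>The variables of \<open>\<phi>\<close> are shifted by \<open>p\<close>, which keeps them apart from the free variables
  \<open>0, \<dots>, p - 1\<close>; \<open>T i j\<close> says that \<open>i\<close> and \<open>j\<close> lie in a common class of the profile.\<close>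

definition profile_body :: "nat set \<Rightarrow> (nat \<Rightarrow> nat \<Rightarrow> bool) \<Rightarrow> nat \<Rightarrow> nat \<Rightarrow> 's sym fm \<Rightarrow> 's sym fm" where
  "profile_body I T r p \<phi> = conjs (
     map (block_fm I r p) [0..<p] @
     map (\<lambda>y. Rel SymInt [p + y]) [0..<block_off I r p] @
     [if T i j then same_block_fm I r p i j else Neg (same_block_fm I r p i j).
       i \<leftarrow> [0..<p], j \<leftarrow> [0..<p], i \<notin> I \<and> j \<notin> I] @
     [relativise p \<phi>])"

definition profile_fm :: "nat set \<Rightarrow> (nat \<Rightarrow> nat \<Rightarrow> bool) \<Rightarrow> nat \<Rightarrow> nat \<Rightarrow> 's sym fm \<Rightarrow> 's sym fm" where
  "profile_fm I T r p \<phi> = foldr Exists [p..<p + block_off I r p] (profile_body I T r p \<phi>)"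

text \<open>An equality is wanted, not just an inclusion, since \<open>local_fm\<close> takes balls
  around the values of exactly the free variables. Each \<open>i < p\<close> occurs in its own
  \<open>block_fm\<close>; the variable 0 coming from \<open>conjs\<close> is covered by
  \<open>p \<ge> 1\<close>.\<close>

lemma fv_profile_fm:
  assumes "p \<ge> 1" "fv \<phi> \<subseteq> {..<block_off I r p}"
  shows "fv (profile_fm I T r p \<phi>) = {..<p}"
proof -
  let ?N = "block_off I r p"
  have len: "block_off I r i + k < ?N" if "i < p" "k < block_len I r i" for i k
    using block_off_mono[of "Suc i" p I r] that by (simp add: block_off_Suc)
  have block: "i \<in> fv (block_fm I r p i)" "fv (block_fm I r p i) \<subseteq> {..<p + ?N}" if "i < p" for i
    using that set_block_vars[OF that, of I r] len[OF that, of 0]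
    by (auto simp: block_fm_def block_len_def)
  have same: "fv (same_block_fm I r p i j) \<subseteq> {..<p + ?N}"
    if "i < p" "j < p" "i \<notin> I" "j \<notin> I" for i j
    using that len[of i] len[of j] assms(1)
    by (auto simp: same_block_fm_def fv_conjs block_len_def)
  have "fv (profile_body I T r p \<phi>) \<subseteq> {..<p + ?N}"
  proof -
    have "fv (relativise p \<phi>) \<subseteq> {..<p + ?N}"
      using assms(2) by (auto simp: fv_relativise)
    then show ?thesis
      unfolding profile_body_def fv_conjs using subsetD[OF block(2)] subsetD[OF same] assms(1)
      by (auto split: if_splits)
  qed
  moreover have "{..<p} \<subseteq> fv (profile_body I T r p \<phi>)"
    unfolding profile_body_def fv_conjs set_append using block(1) by force
  ultimately show ?thesis
    unfolding profile_fm_def fv_foldr_Exists by auto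
qed

lemma fm_over_profile_fm:
  assumes "fm_over (lang_R L r) \<phi>"
  shows "fm_over (lang_star L r) (profile_fm I T r p \<phi>)"
  unfolding profile_fm_def profile_body_def fm_over_foldr_Exists fm_over_conjs
  using fm_over_relativise[OF assms]
  by (auto simp: block_fm_def same_block_fm_def fm_over_conjs lang_star_def length_block_vars
      block_len_def)

text \<open>The meaning of the formula apart from \<open>\<phi>\<close>. Here \<open>u\<close> gives
  the values of the block variables, numbered from 0 without the shift by \<open>p\<close>.\<close>

definition profile_witness :: "nat set \<Rightarrow> (nat \<Rightarrow> nat \<Rightarrow> bool) \<Rightarrow> nat \<Rightarrow> nat \<Rightarrow>
    ('s sym, 'v) struct \<Rightarrow> (nat \<Rightarrow> 'v) \<Rightarrow> (nat \<Rightarrow> 'v) \<Rightarrow> bool" where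
  "profile_witness I T r p M v u \<longleftrightarrow>
     (\<forall>y<block_off I r p. u y \<in> int_verts M) \<and>
     (\<forall>i<p. if i \<in> I then v i = u (block_off I r i)
            else v i # map u (block_vars I r i) \<in> interp M SymRho) \<and>
     (\<forall>i<p. \<forall>j<p. i \<notin> I \<longrightarrow> j \<notin> I \<longrightarrow>
        (map u (block_vars I r i) = map u (block_vars I r j) \<longleftrightarrow> T i j))"

lemma sat_same_block_fm:
  assumes "i \<notin> I" "j \<notin> I"
  shows "sat M v (same_block_fm I r p i j) \<longleftrightarrow>
    map (\<lambda>y. v (p + y)) (block_vars I r i) = map (\<lambda>y. v (p + y)) (block_vars I r j)"
  using assms
  by (auto simp: same_block_fm_def sat_conjs list_eq_iff_nth_eq block_vars_def block_off_Suc
      block_len_def)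

lemma sat_profile_fm:
  assumes "fm_over (lang_R L r) \<phi>" "fv \<phi> \<subseteq> {..<block_off I r p}"
  shows "sat M v (profile_fm I T r p \<phi>) \<longleftrightarrow>
    (\<exists>u. profile_witness I T r p M v u \<and> sat (int_struct M) u \<phi>)"
proof -
  let ?N = "block_off I r p"
  \<comment> \<open>One assignment \<open>w\<close> carries both parts: the tuple on the variables
    below \<open>p\<close>, the blocks from \<open>p\<close> on.\<close>
  have body: "(\<forall>y<?N. w (p + y) \<in> verts M) \<and> sat M w (profile_body I T r p \<phi>) \<longleftrightarrow>
      profile_witness I T r p M w (\<lambda>y. w (p + y)) \<and> sat (int_struct M) (\<lambda>y. w (p + y)) \<phi>" for w
  proof -
    have blocks: "sat M w (block_fm I r p i) \<longleftrightarrow>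
        (if i \<in> I then w i = w (p + block_off I r i)
         else w i # map (\<lambda>y. w (p + y)) (block_vars I r i) \<in> interp M SymRho)" for i
      by (simp add: block_fm_def comp_def)
    have "sat M w (profile_body I T r p \<phi>) \<longleftrightarrow>
        (\<forall>i<p. sat M w (block_fm I r p i)) \<and> (\<forall>y<?N. [w (p + y)] \<in> interp M SymInt) \<and>
        (\<forall>i<p. \<forall>j<p. i \<notin> I \<longrightarrow> j \<notin> I \<longrightarrow> (sat M w (same_block_fm I r p i j) \<longleftrightarrow> T i j)) \<and>
        sat M w (relativise p \<phi>)" (is "_ \<longleftrightarrow> ?B \<and> ?Int \<and> ?S \<and> ?P")
    proof -
      have "sat M w (profile_body I T r p \<phi>) \<longleftrightarrow>
        (\<forall>i<p. sat M w (block_fm I r p i)) \<and> (\<forall>y<?N. [w (p + y)] \<in> interp M SymInt) \<and>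
        (\<forall>i<p. \<forall>j<p. i \<notin> I \<and> j \<notin> I \<longrightarrow>
           sat M w (if T i j then same_block_fm I r p i j else Neg (same_block_fm I r p i j))) \<and>
        sat M w (relativise p \<phi>)"
        unfolding profile_body_def sat_conjs set_append ball_Un
        by (intro arg_cong2[where f = "(\<and>)"]) auto
      moreover have "sat M w (if T i j then same_block_fm I r p i j else Neg (same_block_fm I r p i j))
        \<longleftrightarrow> (sat M w (same_block_fm I r p i j) \<longleftrightarrow> T i j)" for i j
        by simp
      ultimately show ?thesis by blast
    qed
    \<comment> \<open>\<open>sat_relativise\<close> needs internal values. On the left they come
      from the \<open>SymInt\<close> atoms together with membership in \<open>verts M\<close>, on
      the right from \<open>profile_witness\<close>.\<close>
    moreover have "?P \<longleftrightarrow> sat (int_struct M) (\<lambda>y. w (p + y)) \<phi>"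
      if "\<forall>y<?N. w (p + y) \<in> int_verts M"
      using assms that by (intro sat_relativise) auto
    ultimately show ?thesis
      unfolding profile_witness_def by (auto simp: blocks sat_same_block_fm int_verts_def)
  qed
  show ?thesis
  proof
    assume "sat M v (profile_fm I T r p \<phi>)"
    then obtain w where w: "\<forall>x. x \<notin> {p..<p + ?N} \<longrightarrow> w x = v x"
      "\<forall>x\<in>{p..<p + ?N}. w x \<in> verts M" "sat M w (profile_body I T r p \<phi>)"
      unfolding profile_fm_def sat_foldr_Exists by auto
    then have "profile_witness I T r p M w (\<lambda>y. w (p + y)) \<and> sat (int_struct M) (\<lambda>y. w (p + y)) \<phi>"
      by (subst body[symmetric]) auto
    moreover have "profile_witness I T r p M v u \<longleftrightarrow> profile_witness I T r p M w u" for u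
      using w(1) by (simp add: profile_witness_def)
    ultimately show "\<exists>u. profile_witness I T r p M v u \<and> sat (int_struct M) u \<phi>" by blast
  next
    assume "\<exists>u. profile_witness I T r p M v u \<and> sat (int_struct M) u \<phi>"
    then obtain u where u: "profile_witness I T r p M v u" "sat (int_struct M) u \<phi>" by blast
    define w where "w = (\<lambda>x. if x \<in> {p..<p + ?N} then u (x - p) else v x)"
    have w: "w (p + y) = u y" if "y < ?N" for y
      using that by (simp add: w_def)
    have maps: "map (\<lambda>y. w (p + y)) (block_vars I r i) = map u (block_vars I r i)" if "i < p" for i
      using set_block_vars[OF that, of I r] w by auto
    have off: "block_off I r i < ?N" if "i < p" "i \<in> I" for i
      using set_block_vars[OF that(1), of I r] that(2) by (simp add: block_vars_in)
    have "w i = v i" if "i < p" for i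
      using that by (simp add: w_def)
    then have "profile_witness I T r p M w (\<lambda>y. w (p + y))"
      using u(1) unfolding profile_witness_def by (simp add: w maps off)
    moreover have "sat (int_struct M) (\<lambda>y. w (p + y)) \<phi>"
      using u(2) by (subst sat_cong[where w = u]) (use assms(2) w in auto)
    ultimately have "(\<forall>y<?N. w (p + y) \<in> verts M) \<and> sat M w (profile_body I T r p \<phi>)"
      by (simp add: body)
    then show "sat M v (profile_fm I T r p \<phi>)"
      unfolding profile_fm_def sat_foldr_Exists
      by (intro exI[of _ w]) (auto simp: w_def)
  qed
qed

text \<open>One direction of locality, with radius \<open>k + 1\<close>; the other follows by
  exchanging \<open>M\<close> and \<open>M'\<close>. Blocks \<open>u\<close> witnessing the formula
  in \<open>M\<close> lie at distance at most 1 from the tuple. Hence the ball of radius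
  \<open>k\<close> around them in \<open>int_struct M\<close> stays inside the region
  \<open>H\<close> on which \<open>M\<close> and \<open>M'\<close> agree, and the same
  \<open>u\<close> is a witness in \<open>M'\<close>.\<close>

lemma sat_profile_fm_if_same_nbhd:
  fixes M M' :: "('s sym, nat) struct"
  assumes \<phi>: "fm_over (lang_R L r) \<phi>" "fv \<phi> \<subseteq> {..<block_off I r p}" and pr: "p \<ge> 1" "r \<ge> 1"
    and k: "\<forall>(A :: ('s sym, nat) struct) (B :: ('s sym, nat) struct) v.
      fin_struct (lang_R L r) A \<and> fin_struct (lang_R L r) B \<and>
      v ` fv \<phi> \<subseteq> verts A \<and> v ` fv \<phi> \<subseteq> verts B \<and>
      induced A (nbhd A k (v ` fv \<phi>)) = induced B (nbhd B k (v ` fv \<phi>)) \<longrightarrow>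
      (sat A v \<phi> \<longleftrightarrow> sat B v \<phi>)"
    and fin: "fin_struct (lang_star L r) M" "fin_struct (lang_star L r) M'"
    and X: "X = v ` {..<p}" "X \<subseteq> verts M" "X \<subseteq> verts M'"
    and eq: "induced M (nbhd M (k + 1) X) = induced M' (nbhd M' (k + 1) X)"
    and sat: "sat M v (profile_fm I T r p \<phi>)"
  shows "sat M' v (profile_fm I T r p \<phi>)"
proof -
  define H where "H = nbhd M (k + 1) X"
  \<comment> \<open>Balls around vertices contain only vertices, so the intersection with
    \<open>verts\<close> in \<open>induced\<close> loses nothing.\<close>
  have "H = verts M \<inter> nbhd M (k + 1) X" "verts M' \<inter> nbhd M' (k + 1) X = nbhd M' (k + 1) X"
    unfolding H_def using nbhd_subset_verts fin X by blast+
  moreover have "verts M \<inter> nbhd M (k + 1) X = verts M' \<inter> nbhd M' (k + 1) X"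
    using arg_cong[OF eq, of verts] by (simp add: induced_def)
  ultimately have H': "nbhd M' (k + 1) X = H" by simp
  have "{xs \<in> interp M S. set xs \<subseteq> H} = {xs \<in> interp M' S. set xs \<subseteq> H}" for S
    using fun_cong[OF arg_cong[OF eq, of interp], of S] H' by (simp add: induced_def H_def)
  then have agree: "xs \<in> interp M S \<longleftrightarrow> xs \<in> interp M' S" if "set xs \<subseteq> H" for xs S
    using that by blast
  have H_verts: "H \<subseteq> verts M" "H \<subseteq> verts M'"
    using nbhd_subset_verts[OF fin(1) X(2)] nbhd_subset_verts[OF fin(2) X(3)] H'
    unfolding H_def by blast+
  have int: "x \<in> int_verts M \<longleftrightarrow> x \<in> int_verts M'" if "x \<in> H" for x
    using that H_verts agree[of "[x]" SymInt] by (auto simp: int_verts_def)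
  obtain u where u: "profile_witness I T r p M v u" "sat (int_struct M) u \<phi>"
    using sat sat_profile_fm[OF \<phi>] by blast
  have rho: "v i # map u (block_vars I r i) \<in> interp M SymRho" if "i < p" "i \<notin> I" for i
    using u(1) that by (simp add: profile_witness_def)
  \<comment> \<open>An internal entry equals its block variable; an external entry shares a
    \<rho>-tuple with its block.\<close>
  have u1: "u y \<in> nbhd M 1 X" if y: "y < block_off I r p" for y
  proof -
    obtain i where i: "i < p" "y \<in> set (block_vars I r i)" using block_varE[OF y] .
    show ?thesis
    proof (cases "i \<in> I")
      case True
      then have "u y = v i"
        using i u(1) by (auto simp: block_vars_in profile_witness_def)
      then show ?thesis using i X(1) subset_nbhd[of X M 1] by auto
    next
      case False
      let ?xs = "v i # map u (block_vars I r i)"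
      have "?xs \<in> interp M SymRho" "u y \<in> set ?xs" "set ?xs \<inter> nbhd M 0 X \<noteq> {}"
        using rho i False X(1) by (auto simp: nbhd_0)
      then show ?thesis unfolding One_nat_def nbhd_Suc by blast
    qed
  qed
  have uH: "u y \<in> H" if "y < block_off I r p" for y
    using u1[OF that] nbhd_mono[of 1 "k + 1" M X] by (auto simp: H_def)
  have wit: "profile_witness I T r p M' v u"
  proof -
    have "v i # map u (block_vars I r i) \<in> interp M' SymRho" if "i < p" "i \<notin> I" for i
    proof -
      have "set (v i # map u (block_vars I r i)) \<subseteq> H"
        using that set_block_vars[OF that(1), of I r] uH X(1) subset_nbhd[of X M "k + 1"]
        by (auto simp: H_def)
      then show ?thesis using rho[OF that] agree by blast
    qed
    then show ?thesis using u(1) int uH by (simp add: profile_witness_def)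
  qed
  let ?P = "int_struct M" and ?Q = "int_struct M'" and ?U = "u ` fv \<phi>"
  have sub: "interp (int_struct K) S \<subseteq> interp K S" for K :: "('s sym, nat) struct" and S
    by (auto simp: int_struct_def)
  have verts: "verts (int_struct K) = int_verts K" for K :: "('s sym, nat) struct"
    by (simp add: int_struct_def)
  \<comment> \<open>Structures must be nonempty for \<open>k\<close> to apply. Since
    \<open>block_off I r p > 0\<close>, the value \<open>u 0\<close> is an internal vertex of
    both.\<close>
  have ne: "int_verts M \<noteq> {}" "int_verts M' \<noteq> {}"
    using u(1) wit block_off_pos[OF pr, of I] by (auto simp: profile_witness_def)
  have U1: "?U \<subseteq> nbhd M 1 X" using u1 \<phi>(2) by auto
  \<comment> \<open>Bounding balls of \<open>int_struct M'\<close> around the values of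
    \<open>u\<close> requires these to be close to \<open>X\<close> in \<open>M'\<close> as
    well.\<close>
  have "nbhd M' 1 X = nbhd M 1 X"
  proof (rule nbhd_eq_if_agree[where H = H])
    show "nbhd M' 1 X \<subseteq> H" "nbhd M 1 X \<subseteq> H"
      using nbhd_mono[of 1 "k + 1" M' X] nbhd_mono[of 1 "k + 1" M X] H' by (simp_all add: H_def)
  qed (use agree in blast)
  with U1 have U1': "?U \<subseteq> nbhd M' 1 X" by simp
  have PH: "nbhd ?P k ?U \<subseteq> H" "nbhd ?Q k ?U \<subseteq> H"
    using nbhd_subset_nbhd[OF sub U1, of k] nbhd_subset_nbhd[OF sub U1', of k] H'
    by (auto simp: H_def)
  have agree': "xs \<in> interp ?P S \<longleftrightarrow> xs \<in> interp ?Q S" if "set xs \<subseteq> H" for xs S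
  proof -
    have "set xs \<subseteq> int_verts M \<longleftrightarrow> set xs \<subseteq> int_verts M'" using that int by blast
    then show ?thesis using agree[OF that] by (simp add: int_struct_def)
  qed
  have nb: "nbhd ?P k ?U = nbhd ?Q k ?U"
    using nbhd_eq_if_agree[OF agree' PH] .
  have "verts ?P \<inter> nbhd ?P k ?U = verts ?Q \<inter> nbhd ?P k ?U"
    unfolding verts using PH(1) int by blast
  moreover have "{xs \<in> interp ?P S. set xs \<subseteq> nbhd ?P k ?U} =
      {xs \<in> interp ?Q S. set xs \<subseteq> nbhd ?P k ?U}" for S
    using PH(1) agree' by blast
  ultimately have "induced ?P (nbhd ?P k ?U) = induced ?Q (nbhd ?Q k ?U)"
    unfolding induced_def nb[symmetric] by simp
  moreover have "?U \<subseteq> verts ?P" "?U \<subseteq> verts ?Q"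
    unfolding verts using u(1) wit \<phi>(2) unfolding profile_witness_def by blast+
  ultimately have "sat ?P u \<phi> \<longleftrightarrow> sat ?Q u \<phi>"
    by (intro k[rule_format] conjI fin_struct_int_struct fin ne)
  then show ?thesis
    using u(2) wit sat_profile_fm[OF \<phi>] by blast
qed

lemma profile_fm_in_FO_loc:
  fixes \<phi> :: "'s sym fm"
  assumes \<phi>: "fm_over (lang_R L r) \<phi>" "fv \<phi> \<subseteq> {..<block_off I r p}" "local_fm (lang_R L r) \<phi>"
    and pr: "p \<ge> 1" "r \<ge> 1"
  shows "profile_fm I T r p \<phi> \<in> FO_loc p (lang_star L r)"
proof -
  note fv = fv_profile_fm[OF pr(1) \<phi>(2), of T]
  obtain k where k: "\<forall>(A :: ('s sym, nat) struct) (B :: ('s sym, nat) struct) v.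
     fin_struct (lang_R L r) A \<and> fin_struct (lang_R L r) B \<and>
     v ` fv \<phi> \<subseteq> verts A \<and> v ` fv \<phi> \<subseteq> verts B \<and>
     induced A (nbhd A k (v ` fv \<phi>)) = induced B (nbhd B k (v ` fv \<phi>)) \<longrightarrow>
     (sat A v \<phi> \<longleftrightarrow> sat B v \<phi>)"
    using \<phi>(3) unfolding local_fm_def by blast
  have "local_fm (lang_star L r) (profile_fm I T r p \<phi>)"
    unfolding local_fm_def fv
  proof (intro exI[of _ "k + 1"] allI impI, elim conjE)
    fix M M' :: "('s sym, nat) struct" and v
    assume M: "fin_struct (lang_star L r) M" "fin_struct (lang_star L r) M'"
      "v ` {..<p} \<subseteq> verts M" "v ` {..<p} \<subseteq> verts M'"
      "induced M (nbhd M (k + 1) (v ` {..<p})) = induced M' (nbhd M' (k + 1) (v ` {..<p}))"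
    note transfer = sat_profile_fm_if_same_nbhd[OF \<phi>(1,2) pr k]
    show "sat M v (profile_fm I T r p \<phi>) \<longleftrightarrow> sat M' v (profile_fm I T r p \<phi>)"
      using transfer[OF M(1,2) refl M(3-5)] transfer[OF M(2,1) refl M(4,3) M(5)[symmetric]] by blast
  qed
  then show ?thesis
    using fv fm_over_profile_fm[OF \<phi>(1)] by (simp add: FO_loc_def)
qed

section \<open>The gadget construction\<close>

definition classes :: "'i set \<Rightarrow> ('i \<Rightarrow> 'b) \<Rightarrow> 'i set set" where
  "classes J f = (\<lambda>i. {j \<in> J. f j = f i}) ` J"

lemma in_same_class_iff:
  "i \<in> J \<Longrightarrow> j \<in> J \<Longrightarrow> (\<exists>E\<in>classes J f. i \<in> E \<and> j \<in> E) \<longleftrightarrow> f i = f j"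
  unfolding classes_def by fastforce

text \<open>A partition into fibres carries the same information as the relation of having equal
  values. This lets the classes of one tuple stand for those of another.\<close>

lemma classes_eq_iff: "classes J g = classes J f \<longleftrightarrow> (\<forall>i\<in>J. \<forall>j\<in>J. g i = g j \<longleftrightarrow> f i = f j)"
proof
  show "\<forall>i\<in>J. \<forall>j\<in>J. g i = g j \<longleftrightarrow> f i = f j" if eq: "classes J g = classes J f"
  proof (intro ballI)
    fix i j assume ij: "i \<in> J" "j \<in> J"
    show "g i = g j \<longleftrightarrow> f i = f j"
      using in_same_class_iff[OF ij, of g] unfolding eq in_same_class_iff[OF ij] by blast
  qed
  show "classes J g = classes J f" if *: "\<forall>i\<in>J. \<forall>j\<in>J. g i = g j \<longleftrightarrow> f i = f j"
  proof -
    have "{j \<in> J. g j = g i} = {j \<in> J. f j = f i}" if "i \<in> J" for i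
      using * that by blast
    then show ?thesis unfolding classes_def by (rule image_cong[OF refl])
  qed
qed

text \<open>The sorted list is a fold, which is well behaved where insertions commute; for distinct
  elements this is guaranteed by distinct keys. \<open>Min\<close> does not separate arbitrary sets,
  hence the interpretation with carrier \<open>S\<close>.\<close>

lemma set_sorted_key_list_of_set_inj_on:
  assumes "inj_on f S" "finite S"
  shows "set (sorted_key_list_of_set f S) = S"
proof -
  interpret F: folding_on S "insort_key f" "[]"
  proof
    fix x y assume "x \<in> S" "y \<in> S"
    then have "x = y \<or> f x \<noteq> f y" using assms(1) by (auto dest: inj_onD)
    then show "insort_key f y \<circ> insort_key f x = insort_key f x \<circ> insort_key f y"
      using insort_key_left_comm[of f x y] by (auto simp: fun_eq_iff)
  qed
  have "A \<subseteq> S \<Longrightarrow> set (F.F A) = A" if "finite A" for A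
    using that by (induction A rule: finite_induct) (simp_all add: set_insort_key)
  then show ?thesis
    using assms(2) by (simp add: sorted_key_list_of_set_def)
qed

text \<open>Distinct fibres are disjoint and each contains its minimum, so \<open>Min\<close> is
  injective on them.\<close>

lemma set_sorted_classes:
  fixes J :: "nat set"
  assumes "finite J"
  shows "set (sorted_key_list_of_set Min (classes J f)) = classes J f"
proof -
  have "finite E \<and> E \<noteq> {}" if "E \<in> classes J f" for E
    using that assms unfolding classes_def by auto
  then have Min_mem: "Min E \<in> E" if "E \<in> classes J f" for E
    using that Min_in by blast
  have "E = E'" if "E \<in> classes J f" "E' \<in> classes J f" "x \<in> E" "x \<in> E'" for E E' x
    using that unfolding classes_def by auto
  then have "inj_on Min (classes J f)"
    by (intro inj_onI) (metis Min_mem)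
  then show ?thesis
    by (rule set_sorted_key_list_of_set_inj_on) (simp add: classes_def assms)
qed

lemma prob_pmf_of_set:
  assumes "finite S" "S \<noteq> {}"
  shows "\<P>(x in measure_pmf (pmf_of_set S). P x) = real (card {x \<in> S. P x}) / real (card S)"
proof -
  have "S \<inter> {x. P x} = {x \<in> S. P x}" by blast
  then show ?thesis using assms by (simp add: measure_pmf_of_set)
qed

lemma finite_nlists: "finite V \<Longrightarrow> finite (nlists k V)"
  unfolding nlists_def by (rule finite_subset[OF _ finite_lists_length_eq[of V k]]) blast+

section \<open>One base structure with one gadget: vertices and relations of the result\<close>

locale base_and_gadget =
  fixes L :: "'s language" and r :: nat
    and A :: "('s sym, 'a) struct" and G :: "('s, 'g) gadget"
  assumes base: "fin_struct (lang_R L r) A" and gadget: "is_gadget L r G"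
    and no_root_tuple: "\<And>S vs. S \<in> dom L \<Longrightarrow> vs \<in> interp G S \<Longrightarrow> \<not> set vs \<subseteq> set (roots G)"
begin

definition nonroots :: "'g set" where
  "nonroots = verts G - set (roots G)"

lemma interp_R_subset: "interp A SymR \<subseteq> nlists r (verts A)"
proof -
  have "case lang_R L r SymR of None \<Rightarrow> interp A SymR = {} | Some k \<Rightarrow> interp A SymR \<subseteq> nlists k (verts A)"
    using base unfolding fin_struct_def by blast
  then show ?thesis by simp
qed

lemma interp_R: "e \<in> interp A SymR \<Longrightarrow> length e = r" "e \<in> interp A SymR \<Longrightarrow> set e \<subseteq> verts A"
  using interp_R_subset unfolding nlists_def by blast+

lemma finite_verts: "finite (verts A)" "verts A \<noteq> {}" "finite (verts G)" "finite (interp A SymR)"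
proof -
  show A: "finite (verts A)" and "verts A \<noteq> {}"
    using base unfolding fin_struct_def by blast+
  show "finite (verts G)"
    using gadget unfolding is_gadget_def fin_struct_def by blast
  show "finite (interp A SymR)"
    using finite_nlists[OF A] by (rule finite_subset[OF interp_R_subset])
qed

lemma roots: "length (roots G) = r" "set (roots G) \<subseteq> verts G" "distinct (roots G)"
  using gadget unfolding is_gadget_def nlists_def by blast+

text \<open>\<open>glue\<close> touches gadget vertices only at roots, so nothing can be reached
  from a non-root.\<close>

lemma cls_Inr_nonroot:
  assumes "v \<notin> set (roots G)"
  shows "cls A G (Inr (e, v)) = {Inr (e, v)}"
proof -
  have "y = Inr (e, v)" if "(Inr (e, v), y) \<in> (glue A G \<union> (glue A G)\<inverse>)\<^sup>*" for y
    using that by induction (use assms in \<open>auto simp: glue_def\<close>)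
  then show ?thesis by (auto simp: cls_def)
qed

text \<open>Since the roots are distinct, a copy of a root leads back to just one base vertex. Hence
  no two base vertices are ever identified.\<close>

lemma cls_Inl:
  "cls A G (Inl a) =
     insert (Inl a) {Inr (e, roots G ! i) | e i. e \<in> interp A SymR \<and> i < r \<and> e ! i = a}"
  (is "_ = ?C")
proof
  have "y \<in> ?C" if "(Inl a, y) \<in> (glue A G \<union> (glue A G)\<inverse>)\<^sup>*" for y
    using that by induction
      (use roots in \<open>auto simp: glue_def nth_eq_iff_index_eq\<close>)
  then show "cls A G (Inl a) \<subseteq> ?C" by (auto simp: cls_def)
  show "?C \<subseteq> cls A G (Inl a)"
    using roots(1) by (fastforce simp: cls_def glue_def)
qed

lemma cls_Inr_root:
  assumes "e \<in> interp A SymR" "i < r"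
  shows "cls A G (Inr (e, roots G ! i)) = cls A G (Inl (e ! i))"
proof -
  let ?g = "glue A G \<union> (glue A G)\<inverse>"
  have "(Inl (e ! i), Inr (e, roots G ! i)) \<in> ?g" "(Inr (e, roots G ! i), Inl (e ! i)) \<in> ?g"
    using assms roots(1) by (auto simp: glue_def)
  then show ?thesis
    unfolding cls_def by (auto intro: converse_rtrancl_into_rtrancl)
qed

lemma Inl_in_cls_Inl_iff: "Inl a \<in> cls A G (Inl b) \<longleftrightarrow> a = b"
  by (auto simp: cls_Inl)

lemma inj_cls_Inl: "cls A G (Inl a) = cls A G (Inl b) \<longleftrightarrow> a = b"
  by (auto simp: cls_Inl)

lemma cls_Inl_neq [simp]: "cls A G (Inl a) \<noteq> {Inr z}" "{Inr z} \<noteq> cls A G (Inl a)"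
  by (auto simp: cls_Inl)

lemma cls_Inr_cases:
  assumes "e \<in> interp A SymR" "v \<in> verts G"
  obtains a where "a \<in> verts A" "cls A G (Inr (e, v)) = cls A G (Inl a)"
  | "v \<in> nonroots" "cls A G (Inr (e, v)) = {Inr (e, v)}"
proof (cases "v \<in> set (roots G)")
  case True
  then obtain i where "i < r" "v = roots G ! i" using roots(1) by (metis in_set_conv_nth)
  moreover from this have "e ! i \<in> verts A"
    using interp_R[OF assms(1)] by (metis nth_mem subsetD)
  ultimately show ?thesis using that(1) cls_Inr_root assms by blast
next
  case False
  then show ?thesis using that(2) cls_Inr_nonroot assms by (simp add: nonroots_def)
qed

lemma cls_Inr_eq_singleton_iff:
  assumes "e \<in> interp A SymR" "v \<in> verts G"
  shows "cls A G (Inr (e, v)) = {Inr z} \<longleftrightarrow> v \<in> nonroots \<and> z = (e, v)"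
  using assms by (rule cls_Inr_cases) (auto simp: nonroots_def cls_Inr_nonroot)

text \<open>Normal form of the vertices: an external vertex is literally a singleton
  \<open>{Inr (e, v)}\<close> with \<open>v\<close> a non-root, and an internal one is the class of
  a unique base vertex.\<close>

lemma star_verts_eq:
  "star_verts A G = (\<lambda>a. cls A G (Inl a)) ` verts A \<union>
     {{Inr (e, v)} | e v. e \<in> interp A SymR \<and> v \<in> nonroots}"
  (is "_ = ?V")
proof
  show "star_verts A G \<subseteq> ?V"
  proof
    fix x assume "x \<in> star_verts A G"
    then consider a where "a \<in> verts A" "x = cls A G (Inl a)"
      | e v where "e \<in> interp A SymR" "v \<in> verts G" "x = cls A G (Inr (e, v))"
      unfolding star_verts_def by auto
    then show "x \<in> ?V"
    proof cases
      case 2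
      from 2(1,2) show ?thesis by (rule cls_Inr_cases) (use 2 in auto)
    qed auto
  qed
  show "?V \<subseteq> star_verts A G"
  proof
    fix x assume "x \<in> ?V"
    then consider a where "a \<in> verts A" "x = cls A G (Inl a)"
      | e v where "e \<in> interp A SymR" "v \<in> nonroots" "x = {Inr (e, v)}"
      by blast
    then show "x \<in> star_verts A G"
    proof cases
      case 2
      then have "x = cls A G (Inr (e, v))" "v \<in> verts G"
        by (simp_all add: nonroots_def cls_Inr_nonroot)
      with 2 show ?thesis unfolding star_verts_def by blast
    qed (auto simp: star_verts_def)
  qed
qed

lemma internal_eq: "internal A G = (\<lambda>a. cls A G (Inl a)) ` verts A"
proof
  show "internal A G \<subseteq> (\<lambda>a. cls A G (Inl a)) ` verts A"
  proof
    fix x assume "x \<in> internal A G"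
    then obtain a where "x \<in> star_verts A G" "Inl a \<in> x" unfolding internal_def by blast
    then show "x \<in> (\<lambda>a. cls A G (Inl a)) ` verts A" unfolding star_verts_eq by blast
  qed
  show "(\<lambda>a. cls A G (Inl a)) ` verts A \<subseteq> internal A G"
    unfolding internal_def star_verts_eq using Inl_in_cls_Inl_iff by blast
qed

lemma singleton_notin_internal: "{Inr z} \<notin> internal A G"
proof
  assume "{Inr z} \<in> internal A G"
  then obtain a where "{Inr z} = cls A G (Inl a)" unfolding internal_eq by (rule imageE)
  then show False by (simp only: cls_Inl_neq)
qed

lemma external_eq: "external A G = {{Inr (e, v)} | e v. e \<in> interp A SymR \<and> v \<in> nonroots}"
  (is "_ = ?E")
proof -
  have "(\<lambda>a. cls A G (Inl a)) ` verts A \<inter> ?E = {}"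
    using cls_Inl_neq by blast
  then show ?thesis
    unfolding external_def internal_eq star_verts_eq by blast
qed

lemma finite_star_verts: "finite (star_verts A G)" "star_verts A G \<noteq> {}"
  unfolding star_verts_def using finite_verts by auto

text \<open>A singleton class displays its pair \<open>(e, v)\<close>, so the definite description
  in \<open>rho_tuple\<close> has exactly one solution.\<close>

lemma rho_tuple_eq:
  assumes "e \<in> interp A SymR" "v \<in> nonroots"
  shows "rho_tuple A G {Inr (e, v)} = e"
  unfolding rho_tuple_def
proof (rule the_equality)
  show "e \<in> interp A SymR \<and> (\<exists>v'\<in>verts G. {Inr (e, v)} = cls A G (Inr (e, v')))"
    using assms cls_Inr_nonroot[of v e] unfolding nonroots_def by (metis Diff_iff)
  show "e' = e" if "e' \<in> interp A SymR \<and> (\<exists>v'\<in>verts G. {Inr (e, v)} = cls A G (Inr (e', v')))" for e'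
    using that cls_Inr_eq_singleton_iff by (metis fst_conv)
qed

lemma cls_Inr_external_iff:
  assumes "e \<in> interp A SymR"
  shows "v \<in> verts G \<and> cls A G (Inr (e, v)) \<in> external A G \<longleftrightarrow> v \<in> nonroots"
proof
  assume v: "v \<in> verts G \<and> cls A G (Inr (e, v)) \<in> external A G"
  then obtain z where "cls A G (Inr (e, v)) = {Inr z}"
    unfolding external_eq by blast
  then show "v \<in> nonroots"
    using cls_Inr_eq_singleton_iff[OF assms] v by blast
next
  assume "v \<in> nonroots"
  moreover from this have "cls A G (Inr (e, v)) = {Inr (e, v)}" "v \<in> verts G"
    by (simp_all add: nonroots_def cls_Inr_nonroot)
  ultimately show "v \<in> verts G \<and> cls A G (Inr (e, v)) \<in> external A G"
    using assms unfolding external_eq by blast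
qed

lemma interp_Rho:
  "interp (gadget_star A G) SymRho =
     {{Inr (e, v)} # map (\<lambda>a. cls A G (Inl a)) e | e v. e \<in> interp A SymR \<and> v \<in> nonroots}"
proof -
  have "xs = cls A G (Inr (e, v)) # map (\<lambda>a. cls A G (Inl a)) e \<and>
      e \<in> interp A SymR \<and> v \<in> verts G \<and> cls A G (Inr (e, v)) \<in> external A G \<longleftrightarrow>
      xs = {Inr (e, v)} # map (\<lambda>a. cls A G (Inl a)) e \<and> e \<in> interp A SymR \<and> v \<in> nonroots"
    for xs e v
  proof (cases "e \<in> interp A SymR \<and> v \<in> nonroots")
    case True
    then have "cls A G (Inr (e, v)) = {Inr (e, v)}"
      by (simp add: nonroots_def cls_Inr_nonroot)
    then show ?thesis using True cls_Inr_external_iff[of e v] by presburger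
  next
    case False
    then show ?thesis using cls_Inr_external_iff[of e v] by blast
  qed
  then show ?thesis
    unfolding gadget_star_def struct.simps star_interp.simps by presburger
qed

lemma int_verts_gadget_star: "int_verts (gadget_star A G) = (\<lambda>a. cls A G (Inl a)) ` verts A"
  unfolding internal_eq[symmetric] by (auto simp: int_verts_def gadget_star_def internal_def)

text \<open>Here the hypothesis on root tuples enters. Every gadget tuple contains a non-root, whose
  class is external, so restricting to internal vertices discards all gadget tuples and keeps those
  coming from \<open>A\<close>.\<close>

lemma interp_int_struct:
  "interp (int_struct (gadget_star A G)) S = map (\<lambda>a. cls A G (Inl a)) ` interp A S"
proof -
  let ?c = "\<lambda>a. cls A G (Inl a)"
  have case_A: "case lang_R L r S of None \<Rightarrow> interp A S = {} | Some k \<Rightarrow> interp A S \<subseteq> nlists k (verts A)"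
    using base unfolding fin_struct_def by blast
  have empty: "interp A S = {}" if "S \<in> {SymInt, SymExt, SymRho}"
  proof -
    from that have "lang_R L r S = None" by auto
    with case_A show ?thesis by simp
  qed
  have sub: "set xs \<subseteq> verts A" if "xs \<in> interp A S" for xs
    using interp_subset_lists[OF base that] .
  show ?thesis
  proof (cases S)
    case (Sym S')
    have misfits: "\<not> set (map (\<lambda>v. cls A G (Inr (e, v))) vs) \<subseteq> ?c ` verts A"
      if vs: "vs \<in> interp G S'" for e vs
    proof -
      have G: "case L S' of None \<Rightarrow> interp G S' = {} | Some k \<Rightarrow> interp G S' \<subseteq> nlists k (verts G)"
        using gadget unfolding is_gadget_def fin_struct_def by blast
      \<comment> \<open>A symbol outside \<open>L\<close> has no gadget tuples, so \<open>S'\<close>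
        is among the symbols that \<open>no_root_tuple\<close> covers.\<close>
      have "S' \<in> dom L"
      proof (rule ccontr)
        assume "S' \<notin> dom L"
        then have "L S' = None" by (simp add: domIff)
        with G have "interp G S' = {}" by simp
        with vs show False by simp
      qed
      then obtain v where v: "v \<in> set vs" "v \<notin> set (roots G)"
        using no_root_tuple vs by blast
      have "cls A G (Inr (e, v)) \<notin> ?c ` verts A"
        unfolding cls_Inr_nonroot[OF v(2)] internal_eq[symmetric] by (rule singleton_notin_internal)
      moreover have "cls A G (Inr (e, v)) \<in> set (map (\<lambda>v. cls A G (Inr (e, v))) vs)"
        using v(1) by simp
      ultimately show ?thesis by blast
    qed
    have fits: "set (map ?c as) \<subseteq> ?c ` verts A" if "as \<in> interp A S" for as
      using image_mono[OF sub[OF that]] by simp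
    have star: "interp (int_struct (gadget_star A G)) S =
        {xs \<in> star_interp A G S. set xs \<subseteq> ?c ` verts A}"
      unfolding int_struct_def int_verts_gadget_star by (simp add: Sym gadget_star_def)
    show ?thesis
    proof (intro equalityI subsetI)
      fix xs assume "xs \<in> interp (int_struct (gadget_star A G)) S"
      then have "xs \<in> star_interp A G (Sym S') \<and> set xs \<subseteq> ?c ` verts A"
        unfolding star unfolding Sym by (rule CollectD)
      then have xs: "xs \<in> star_interp A G (Sym S')" "set xs \<subseteq> ?c ` verts A" by blast+
      from xs(1) consider as where "xs = map ?c as" "as \<in> interp A (Sym S')"
        | e vs where "xs = map (\<lambda>v. cls A G (Inr (e, v))) vs" "vs \<in> interp G S'"
        unfolding star_interp.simps by blast
      then show "xs \<in> map ?c ` interp A S"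
      proof cases
        case 1
        then show ?thesis unfolding Sym by (rule image_eqI)
      next
        case 2
        then show ?thesis using xs(2) misfits by metis
      qed
    next
      fix xs assume "xs \<in> map ?c ` interp A S"
      then obtain as where as: "xs = map ?c as" "as \<in> interp A S" by (rule imageE)
      moreover have "xs \<in> star_interp A G S"
        using as unfolding Sym star_interp.simps by blast
      ultimately show "xs \<in> interp (int_struct (gadget_star A G)) S"
        unfolding star using fits by (metis (mono_tags, lifting) CollectI)
    qed
  next
    case SymR
    have "set (map ?c as) \<subseteq> ?c ` verts A" if "as \<in> interp A S" for as
      using sub[OF that] by auto
    moreover have "interp (int_struct (gadget_star A G)) S =
        {xs \<in> star_interp A G S. set xs \<subseteq> ?c ` verts A}"
      unfolding int_struct_def int_verts_gadget_star by (simp add: SymR gadget_star_def)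
    ultimately show ?thesis unfolding SymR star_interp.simps by blast
  qed (use empty in \<open>simp_all add: int_struct_def\<close>)
qed

lemma sat_int_struct:
  assumes "v ` fv \<phi> \<subseteq> verts A"
  shows "sat (int_struct (gadget_star A G)) (\<lambda>x. cls A G (Inl (v x))) \<phi> \<longleftrightarrow> sat A v \<phi>"
proof (rule sat_isomorphic[OF _ _ _ _ assms])
  show "inj_on (\<lambda>a. cls A G (Inl a)) (verts A)"
    by (simp add: inj_on_def inj_cls_Inl)
  show "verts (int_struct (gadget_star A G)) = (\<lambda>a. cls A G (Inl a)) ` verts A"
    unfolding int_verts_gadget_star[symmetric] by (simp add: int_struct_def)
  show "interp A S \<subseteq> lists (verts A)" for S
    using interp_subset_lists[OF base] by blast
qed (rule interp_int_struct)

section \<open>Tuples of the construction as base blocks together with gadget vertices\<close>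

definition blocks :: "nat \<Rightarrow> nat set \<Rightarrow> 'a list list set" where
  "blocks p I = {bs. length bs = p \<and> (\<forall>i<p. bs ! i \<in> nlists (block_len I r i) (verts A))}"

text \<open>This is \<open>respects_profile\<close> with the relation of lying in a common class
  abstracted to \<open>T\<close>.\<close>

definition blocks_fit :: "nat \<Rightarrow> nat set \<Rightarrow> (nat \<Rightarrow> nat \<Rightarrow> bool) \<Rightarrow> 'a list list \<Rightarrow> bool" where
  "blocks_fit p I T bs \<longleftrightarrow> (\<forall>i<p. i \<notin> I \<longrightarrow> bs ! i \<in> interp A SymR) \<and>
     (\<forall>i<p. \<forall>j<p. i \<notin> I \<longrightarrow> j \<notin> I \<longrightarrow> (bs ! i = bs ! j \<longleftrightarrow> T i j))"

definition glue_blocks :: "nat \<Rightarrow> nat set \<Rightarrow> 'a list list \<times> (nat \<Rightarrow> 'g) \<Rightarrow> ('a, 'g) pre_vertex set list" where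
  "glue_blocks p I = (\<lambda>(bs, w).
     map (\<lambda>i. if i \<in> I then cls A G (Inl (bs ! i ! 0)) else {Inr (bs ! i, w i)}) [0..<p])"

text \<open>Extensional functions, so that each choice at the external positions is counted once.
  For \<open>I \<subseteq> {..<p}\<close> the cardinality is that of \<open>nonroots\<close> to the
  power \<open>p - card I\<close>.\<close>

definition choices :: "nat \<Rightarrow> nat set \<Rightarrow> (nat \<Rightarrow> 'g) set" where
  "choices p I = ({..<p} - I) \<rightarrow>\<^sub>E nonroots"

lemma blocksD:
  assumes "bs \<in> blocks p I" "i < p"
  shows "length (bs ! i) = block_len I r i" "set (bs ! i) \<subseteq> verts A"
  using assms unfolding blocks_def nlists_def by blast+

lemma nth_glue_blocks:
  "i < p \<Longrightarrow> glue_blocks p I (bs, w) ! i =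
     (if i \<in> I then cls A G (Inl (bs ! i ! 0)) else {Inr (bs ! i, w i)})"
  by (simp add: glue_blocks_def)

lemma length_glue_blocks: "length (glue_blocks p I z) = p"
  by (simp add: glue_blocks_def case_prod_beta)

text \<open>A singleton \<open>{Inr (e, v)}\<close> reveals both \<open>e\<close> and
  \<open>v\<close>, and the class of a base vertex reveals that vertex; outside the external
  positions \<open>w\<close> is fixed by extensionality.\<close>

lemma inj_on_glue_blocks: "inj_on (glue_blocks p I) (blocks p I \<times> choices p I)"
proof (rule inj_onI, clarify)
  fix bs w bs' w'
  assume bs: "bs \<in> blocks p I" "bs' \<in> blocks p I" and w: "w \<in> choices p I" "w' \<in> choices p I"
    and eq: "glue_blocks p I (bs, w) = glue_blocks p I (bs', w')"
  have nth: "(if i \<in> I then cls A G (Inl (bs ! i ! 0)) else {Inr (bs ! i, w i)}) =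
      (if i \<in> I then cls A G (Inl (bs' ! i ! 0)) else {Inr (bs' ! i, w' i)})" if "i < p" for i
    using arg_cong[OF eq, of "\<lambda>xs. xs ! i"] unfolding nth_glue_blocks[OF that] .
  have "bs ! i = bs' ! i" if "i < p" for i
  proof (cases "i \<in> I")
    case True
    have "length (bs ! i) = 1" "length (bs' ! i) = 1"
      using blocksD(1) bs that True by (simp_all add: block_len_def)
    moreover have "bs ! i ! 0 = bs' ! i ! 0"
      using nth[OF that] True by (simp add: inj_cls_Inl)
    ultimately show ?thesis by (simp add: list_eq_iff_nth_eq)
  next
    case False
    then show ?thesis using nth[OF that] by simp
  qed
  moreover have "length bs = p" "length bs' = p" using bs by (simp_all add: blocks_def)
  ultimately have "bs = bs'" by (simp add: list_eq_iff_nth_eq)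
  moreover have "w = w'"
  proof (rule PiE_ext[of _ "{..<p} - I" "\<lambda>_. nonroots"])
    show "w i = w' i" if "i \<in> {..<p} - I" for i
      using nth[of i] that by simp
  qed (use w in \<open>simp_all add: choices_def\<close>)
  ultimately show "bs = bs' \<and> w = w'" by simp
qed

lemma glue_blocks_in_nlists:
  assumes "bs \<in> blocks p I" "blocks_fit p I T bs" "w \<in> choices p I"
  shows "glue_blocks p I (bs, w) \<in> nlists p (star_verts A G)"
proof -
  have "cls A G (Inl (bs ! i ! 0)) \<in> star_verts A G" if "i < p" "i \<in> I" for i
  proof -
    have "length (bs ! i) = 1" "set (bs ! i) \<subseteq> verts A"
      using blocksD[OF assms(1) that(1)] that(2) by (simp_all add: block_len_def)
    then have "bs ! i ! 0 \<in> verts A" by (metis nth_mem subsetD zero_less_one)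
    then show ?thesis unfolding star_verts_eq by blast
  qed
  moreover have "{Inr (bs ! i, w i)} \<in> star_verts A G" if "i < p" "i \<notin> I" for i
  proof -
    have "bs ! i \<in> interp A SymR" "w i \<in> nonroots"
      using assms(2,3) that by (auto simp: blocks_fit_def choices_def)
    then show ?thesis unfolding star_verts_eq by blast
  qed
  ultimately show ?thesis
    by (auto simp: glue_blocks_def intro!: nlistsI)
qed

text \<open>The set is the image of a product: satisfaction constrains only the blocks, while the
  gadget vertices range freely over the non-roots. This is what makes the count factor.\<close>

lemma profile_fm_tuples:
  assumes \<phi>: "fm_over (lang_R L r) \<phi>" "fv \<phi> \<subseteq> {..<block_off I r p}"
  shows "{as \<in> nlists p (star_verts A G). sat (gadget_star A G) ((!) as) (profile_fm I T r p \<phi>)} =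
    glue_blocks p I ` ({bs \<in> blocks p I. blocks_fit p I T bs \<and> sat A ((!) (concat bs)) \<phi>} \<times> choices p I)"
    (is "?L = ?R")
proof
  let ?c = "\<lambda>a. cls A G (Inl a)" and ?N = "block_off I r p"
  show "?L \<subseteq> ?R"
  proof
    fix as assume as: "as \<in> ?L"
    then obtain u where u: "profile_witness I T r p (gadget_star A G) ((!) as) u"
      and sat: "sat (int_struct (gadget_star A G)) u \<phi>"
      using sat_profile_fm[OF \<phi>] by blast
    \<comment> \<open>The block values are internal, so they pull back to vertices
      \<open>f y\<close> of \<open>A\<close>, from which the blocks \<open>bs\<close> are
      formed.\<close>
    have "\<forall>y. \<exists>a. y < ?N \<longrightarrow> a \<in> verts A \<and> u y = ?c a"
      using u unfolding profile_witness_def int_verts_gadget_star by blast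
    then obtain f where f: "\<And>y. y < ?N \<Longrightarrow> f y \<in> verts A" "\<And>y. y < ?N \<Longrightarrow> u y = ?c (f y)"
      by metis
    define bs where "bs = map (\<lambda>i. map f (block_vars I r i)) [0..<p]"
    have bs_nth: "bs ! i = map f (block_vars I r i)" if "i < p" for i
      using that by (simp add: bs_def)
    have u_block: "map u (block_vars I r i) = map ?c (bs ! i)" if "i < p" for i
      using set_block_vars[OF that, of I r] f(2) bs_nth[OF that] by auto
    have inj: "map ?c xs = map ?c ys \<longleftrightarrow> xs = ys" for xs ys
      by (rule inj_map_eq_map) (auto simp: inj_def inj_cls_Inl)
    have bs: "bs \<in> blocks p I"
      unfolding blocks_def
    proof (intro CollectI conjI allI impI)
      fix i assume "i < p"
      then show "bs ! i \<in> nlists (block_len I r i) (verts A)"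
        using subsetD[OF set_block_vars[of i p I r]] f(1)
        by (auto simp: bs_nth length_block_vars intro!: nlistsI)
    qed (simp add: bs_def)
    \<comment> \<open>\<open>interp_Rho\<close> gives an external entry the form
      \<open>{Inr (e, v)}\<close>, and injectivity of the classes identifies \<open>e\<close> with
      the block.\<close>
    have "\<forall>i. \<exists>v. i < p \<longrightarrow> i \<notin> I \<longrightarrow> bs ! i \<in> interp A SymR \<and> v \<in> nonroots \<and> as ! i = {Inr (bs ! i, v)}"
    proof
      fix i
      show "\<exists>v. i < p \<longrightarrow> i \<notin> I \<longrightarrow> bs ! i \<in> interp A SymR \<and> v \<in> nonroots \<and> as ! i = {Inr (bs ! i, v)}"
      proof (cases "i < p \<and> i \<notin> I")
        case True
        then have "as ! i # map u (block_vars I r i) \<in> interp (gadget_star A G) SymRho"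
          using u unfolding profile_witness_def by metis
        then have "as ! i # map ?c (bs ! i) \<in> interp (gadget_star A G) SymRho"
          using True u_block[of i] by metis
        then obtain e v where "as ! i # map ?c (bs ! i) = {Inr (e, v)} # map ?c e"
          "e \<in> interp A SymR" "v \<in> nonroots"
          unfolding interp_Rho by blast
        then show ?thesis using inj by auto
      qed auto
    qed
    then obtain w0 where w0: "\<And>i. i < p \<Longrightarrow> i \<notin> I \<Longrightarrow>
        bs ! i \<in> interp A SymR \<and> w0 i \<in> nonroots \<and> as ! i = {Inr (bs ! i, w0 i)}"
      by metis
    define w where "w = restrict w0 ({..<p} - I)"
    have w: "w \<in> choices p I" using w0 by (auto simp: w_def choices_def)
    have resp: "blocks_fit p I T bs"
      using u w0 u_block inj unfolding blocks_fit_def profile_witness_def by metis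
    have "as ! i = glue_blocks p I (bs, w) ! i" if "i < p" for i
    proof (cases "i \<in> I")
      case True
      then have "as ! i = u (block_off I r i)" using u that by (simp add: profile_witness_def)
      moreover have "block_off I r i < ?N"
        using set_block_vars[OF that, of I r] True by (simp add: block_vars_in)
      ultimately have "as ! i = ?c (f (block_off I r i))" using f(2) by simp
      then show ?thesis using that True by (simp add: glue_blocks_def bs_nth block_vars_in)
    next
      case False
      then show ?thesis using w0 that by (simp add: glue_blocks_def w_def)
    qed
    then have "as = glue_blocks p I (bs, w)"
      using nlistsE_length[of as p] as by (intro nth_equalityI) (auto simp: length_glue_blocks)
    moreover have "sat A ((!) (concat bs)) \<phi>"
    proof -
      have "concat bs = map f [0..<?N]"
        unfolding bs_def concat_block_vars[symmetric] by (simp add: map_concat comp_def)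
      then have "\<And>x. x \<in> fv \<phi> \<Longrightarrow> concat bs ! x = f x" using \<phi>(2) by auto
      then have "sat A ((!) (concat bs)) \<phi> \<longleftrightarrow> sat A f \<phi>" by (rule sat_cong)
      also have "\<dots> \<longleftrightarrow> sat (int_struct (gadget_star A G)) (\<lambda>x. ?c (f x)) \<phi>"
        using \<phi>(2) f(1) by (intro sat_int_struct[symmetric]) auto
      also have "\<dots> \<longleftrightarrow> sat (int_struct (gadget_star A G)) u \<phi>"
        using \<phi>(2) f(2) by (intro sat_cong) auto
      finally show ?thesis using sat by simp
    qed
    ultimately show "as \<in> ?R" using bs w resp by blast
  qed
  show "?R \<subseteq> ?L"
  proof
    fix as assume "as \<in> ?R"
    then obtain bs w where bs: "bs \<in> blocks p I" "blocks_fit p I T bs" "sat A ((!) (concat bs)) \<phi>"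
      and w: "w \<in> choices p I" and as: "as = glue_blocks p I (bs, w)"
      by blast
    have len: "length bs = p" using bs(1) by (simp add: blocks_def)
    have bs_nth: "bs ! i = map ((!) (concat bs)) (block_vars I r i)" if "i < p" for i
      using that len blocksD(1)[OF bs(1)] by (intro nth_eq_map_concat) auto
    have conc: "concat bs ! y \<in> verts A" if y: "y < ?N" for y
    proof -
      obtain i where i: "i < p" "y \<in> set (block_vars I r i)" using block_varE[OF y] .
      then have "concat bs ! y \<in> set (bs ! i)" by (simp add: bs_nth)
      then show ?thesis using blocksD(2)[OF bs(1) i(1)] by blast
    qed
    let ?u = "\<lambda>y. ?c (concat bs ! y)"
    have u_block: "map ?u (block_vars I r i) = map ?c (bs ! i)" if "i < p" for i
      by (subst bs_nth[OF that]) simp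
    have inj: "map ?c xs = map ?c ys \<longleftrightarrow> xs = ys" for xs ys
      by (rule inj_map_eq_map) (auto simp: inj_def inj_cls_Inl)
    have "profile_witness I T r p (gadget_star A G) ((!) as) ?u"
      unfolding profile_witness_def
    proof (intro conjI allI impI)
      show "?u y \<in> int_verts (gadget_star A G)" if "y < ?N" for y
        using conc[OF that] unfolding int_verts_gadget_star by blast
      show "map ?u (block_vars I r i) = map ?u (block_vars I r j) \<longleftrightarrow> T i j"
        if "i < p" "j < p" "i \<notin> I" "j \<notin> I" for i j
        using bs(2) that unfolding u_block[OF that(1)] u_block[OF that(2)] inj blocks_fit_def by blast
      show "if i \<in> I then as ! i = ?u (block_off I r i)
          else as ! i # map ?u (block_vars I r i) \<in> interp (gadget_star A G) SymRho" if i: "i < p" for i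
      proof (cases "i \<in> I")
        case True
        then have "bs ! i ! 0 = concat bs ! block_off I r i"
          by (subst bs_nth[OF i]) (simp add: block_vars_in)
        then show ?thesis using True i by (simp add: as glue_blocks_def)
      next
        case False
        have "bs ! i \<in> interp A SymR" "w i \<in> nonroots"
          using bs(2) w i False by (auto simp: blocks_fit_def choices_def)
        moreover have "as ! i = {Inr (bs ! i, w i)}"
          using False i by (simp add: as glue_blocks_def)
        ultimately have "as ! i # map ?c (bs ! i) \<in> interp (gadget_star A G) SymRho"
          unfolding interp_Rho by blast
        then show ?thesis using False u_block[OF i] by simp
      qed
    qed
    moreover have "sat (int_struct (gadget_star A G)) ?u \<phi>"
      using bs(3) by (subst sat_int_struct) (use \<phi>(2) conc in auto)
    ultimately have "sat (gadget_star A G) ((!) as) (profile_fm I T r p \<phi>)"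
      using sat_profile_fm[OF \<phi>] by blast
    then show "as \<in> ?L"
      using glue_blocks_in_nlists[OF bs(1,2) w] as by simp
  qed
qed

lemma profile_eq_classes:
  assumes "as \<in> nlists p (star_verts A G)" "I = {i. i < p \<and> as ! i \<in> internal A G}"
  shows "profile A G as =
    (I, sorted_key_list_of_set Min (classes ({..<p} - I) (\<lambda>i. rho_tuple A G (as ! i))))"
proof -
  note len = nlistsE_length[OF assms(1)] and V = nlistsE_nth_in[OF assms(1)]
  have "{i. i < p \<and> as ! i \<in> external A G} = {..<p} - I"
    using V by (auto simp: external_def assms(2))
  then show ?thesis
    unfolding profile_def Let_def len classes_def assms(2) by simp
qed

text \<open>Sorting loses nothing: \<open>set_sorted_classes\<close> recovers the classes from the
  list, and \<open>classes_eq_iff\<close> reduces them to equality of values.\<close>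

lemma profile_eq_iff:
  assumes as: "as \<in> nlists p (star_verts A G)" and "I \<subseteq> {..<p}"
  shows "profile A G as = (I, sorted_key_list_of_set Min (classes ({..<p} - I) f)) \<longleftrightarrow>
    (\<forall>i<p. as ! i \<in> internal A G \<longleftrightarrow> i \<in> I) \<and>
    (\<forall>i<p. \<forall>j<p. i \<notin> I \<longrightarrow> j \<notin> I \<longrightarrow>
       (rho_tuple A G (as ! i) = rho_tuple A G (as ! j) \<longleftrightarrow> f i = f j))"
proof -
  let ?I = "{i. i < p \<and> as ! i \<in> internal A G}" and ?g = "\<lambda>i. rho_tuple A G (as ! i)"
  note profile = profile_eq_classes[OF as refl]
  have int: "?I = I \<longleftrightarrow> (\<forall>i<p. as ! i \<in> internal A G \<longleftrightarrow> i \<in> I)"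
    using assms(2) by auto
  have "sorted_key_list_of_set Min (classes ({..<p} - I) ?g) =
      sorted_key_list_of_set Min (classes ({..<p} - I) f) \<longleftrightarrow>
      classes ({..<p} - I) ?g = classes ({..<p} - I) f"
    using set_sorted_classes[of "{..<p} - I"] by (metis finite_Diff finite_lessThan)
  also have "\<dots> \<longleftrightarrow>
      (\<forall>i<p. \<forall>j<p. i \<notin> I \<longrightarrow> j \<notin> I \<longrightarrow> (?g i = ?g j \<longleftrightarrow> f i = f j))"
    unfolding classes_eq_iff by auto
  finally have Es: "sorted_key_list_of_set Min (classes ({..<p} - I) ?g) =
      sorted_key_list_of_set Min (classes ({..<p} - I) f) \<longleftrightarrow>
      (\<forall>i<p. \<forall>j<p. i \<notin> I \<longrightarrow> j \<notin> I \<longrightarrow> (?g i = ?g j \<longleftrightarrow> f i = f j))" .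
  show ?thesis
  proof (cases "?I = I")
    case True
    then show ?thesis unfolding profile prod.inject True Es int[symmetric] by simp
  next
    case False
    then show ?thesis unfolding profile prod.inject int[symmetric] by blast
  qed
qed

text \<open>The same product shape, with the same factor \<open>choices p I\<close>, as in
  \<open>profile_fm_tuples\<close>; that factor will cancel in a quotient. Any \<open>f\<close>
  whose fibres are the classes of the profile may be used.\<close>

lemma profile_tuples:
  assumes I: "I \<subseteq> {..<p}"
    and T: "\<And>i j. i < p \<Longrightarrow> j < p \<Longrightarrow> i \<notin> I \<Longrightarrow> j \<notin> I \<Longrightarrow> T i j \<longleftrightarrow> f i = f j"
  shows "{as \<in> nlists p (star_verts A G).
      profile A G as = (I, sorted_key_list_of_set Min (classes ({..<p} - I) f))} =
    glue_blocks p I ` ({bs \<in> blocks p I. blocks_fit p I T bs} \<times> choices p I)"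
    (is "?L = ?R")
proof
  show "?L \<subseteq> ?R"
  proof
    fix as assume "as \<in> ?L"
    then have V: "as \<in> nlists p (star_verts A G)"
      and "profile A G as = (I, sorted_key_list_of_set Min (classes ({..<p} - I) f))"
      by blast+
    from iffD1[OF profile_eq_iff[OF this(1) I] this(2)]
    have int: "\<And>i. i < p \<Longrightarrow> as ! i \<in> internal A G \<longleftrightarrow> i \<in> I"
      and rho: "\<And>i j. i < p \<Longrightarrow> j < p \<Longrightarrow> i \<notin> I \<Longrightarrow> j \<notin> I \<Longrightarrow>
        rho_tuple A G (as ! i) = rho_tuple A G (as ! j) \<longleftrightarrow> f i = f j"
      by blast+
    have len: "length as = p" using V by (rule nlistsE_length)
    have "\<exists>a. i < p \<longrightarrow> i \<in> I \<longrightarrow> a \<in> verts A \<and> as ! i = cls A G (Inl a)" for i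
      using int[of i] unfolding internal_eq by blast
    then obtain a where a: "\<And>i. i < p \<Longrightarrow> i \<in> I \<Longrightarrow> a i \<in> verts A \<and> as ! i = cls A G (Inl (a i))"
      by metis
    have "\<exists>e v. i < p \<longrightarrow> i \<notin> I \<longrightarrow> e \<in> interp A SymR \<and> v \<in> nonroots \<and> as ! i = {Inr (e, v)}" for i
    proof (cases "i < p \<and> i \<notin> I")
      case True
      then have "as ! i \<in> external A G"
        using int[of i] nlistsE_nth_in[OF V] by (simp add: external_def)
      then show ?thesis unfolding external_eq by blast
    qed blast
    then obtain e w0 where ew: "\<And>i. i < p \<Longrightarrow> i \<notin> I \<Longrightarrow>
        e i \<in> interp A SymR \<and> w0 i \<in> nonroots \<and> as ! i = {Inr (e i, w0 i)}"
      by metis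
    define bs where "bs = map (\<lambda>i. if i \<in> I then [a i] else e i) [0..<p]"
    define w where "w = restrict w0 ({..<p} - I)"
    have bs_nth: "bs ! i = (if i \<in> I then [a i] else e i)" if "i < p" for i
      using that by (simp add: bs_def)
    have w: "w \<in> choices p I" using ew by (auto simp: w_def choices_def)
    have "bs ! i \<in> nlists (block_len I r i) (verts A)" if "i < p" for i
      using that a[OF that] ew[OF that] interp_R[of "e i"]
      by (intro nlistsI) (simp_all add: bs_nth block_len_def)
    then have bs: "bs \<in> blocks p I" by (simp add: blocks_def bs_def)
    have fit: "blocks_fit p I T bs"
      unfolding blocks_fit_def
    proof (intro conjI allI impI)
      show "bs ! i \<in> interp A SymR" if "i < p" "i \<notin> I" for i
        using that ew by (simp add: bs_nth)
      have rho_e: "rho_tuple A G (as ! i) = e i" if "i < p" "i \<notin> I" for i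
        using ew[OF that] rho_tuple_eq by simp
      show "bs ! i = bs ! j \<longleftrightarrow> T i j" if "i < p" "j < p" "i \<notin> I" "j \<notin> I" for i j
        using rho[OF that] T[OF that] that by (simp add: bs_nth rho_e)
    qed
    have "as = glue_blocks p I (bs, w)"
    proof (rule nth_equalityI)
      fix i assume "i < length as"
      then have i: "i < p" using len by simp
      show "as ! i = glue_blocks p I (bs, w) ! i"
        using a[OF i] ew[OF i] i by (simp add: nth_glue_blocks bs_nth w_def)
    qed (simp add: len length_glue_blocks)
    then show "as \<in> ?R" using bs fit w by blast
  qed
  show "?R \<subseteq> ?L"
  proof
    fix as assume "as \<in> ?R"
    then obtain bs w where bs: "bs \<in> blocks p I" "blocks_fit p I T bs" and w: "w \<in> choices p I"
      and as: "as = glue_blocks p I (bs, w)"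
      by blast
    have V: "as \<in> nlists p (star_verts A G)"
      using glue_blocks_in_nlists[OF bs w] as by simp
    have ext: "bs ! i \<in> interp A SymR \<and> w i \<in> nonroots \<and> as ! i = {Inr (bs ! i, w i)}"
      if "i < p" "i \<notin> I" for i
      using bs(2) w that by (auto simp: blocks_fit_def choices_def as nth_glue_blocks)
    have "as ! i \<in> internal A G \<longleftrightarrow> i \<in> I" if i: "i < p" for i
    proof (cases "i \<in> I")
      case True
      then have "length (bs ! i) = 1" "set (bs ! i) \<subseteq> verts A"
        using blocksD[OF bs(1) i] by (simp_all add: block_len_def)
      then have "bs ! i ! 0 \<in> verts A" by (metis nth_mem subsetD zero_less_one)
      then show ?thesis
        using True i unfolding internal_eq by (simp add: as nth_glue_blocks)
    next
      case False
      then have "as ! i = {Inr (bs ! i, w i)}" using ext[OF i] by blast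
      then show ?thesis
        using False singleton_notin_internal by simp
    qed
    moreover have "rho_tuple A G (as ! i) = rho_tuple A G (as ! j) \<longleftrightarrow> f i = f j"
      if "i < p" "j < p" "i \<notin> I" "j \<notin> I" for i j
    proof -
      have "rho_tuple A G (as ! i) = bs ! i" "rho_tuple A G (as ! j) = bs ! j"
        using ext rho_tuple_eq that by simp_all
      then show ?thesis
        using bs(2) T[OF that] that unfolding blocks_fit_def by metis
    qed
    ultimately show "as \<in> ?L"
      by (intro CollectI conjI V iffD2[OF profile_eq_iff[OF V I]]) blast+
  qed
qed

section \<open>Counting, and probabilities as ratios of counts\<close>

lemma finite_blocks: "finite (blocks p I)"
proof -
  have "finite {bs. set bs \<subseteq> nlists 1 (verts A) \<union> nlists r (verts A) \<and> length bs = p}"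
    using finite_nlists[OF finite_verts(1)] by (intro finite_lists_length_eq) simp
  moreover have "blocks p I \<subseteq> {bs. set bs \<subseteq> nlists 1 (verts A) \<union> nlists r (verts A) \<and> length bs = p}"
  proof
    fix bs assume bs: "bs \<in> blocks p I"
    have "b \<in> nlists 1 (verts A) \<union> nlists r (verts A)" if "b \<in> set bs" for b
    proof -
      from that obtain i where "i < length bs" "b = bs ! i" by (metis in_set_conv_nth)
      then have "b \<in> nlists (block_len I r i) (verts A)" using bs unfolding blocks_def by blast
      then show ?thesis unfolding block_len_def by (cases "i \<in> I") simp_all
    qed
    then show "bs \<in> {bs. set bs \<subseteq> nlists 1 (verts A) \<union> nlists r (verts A) \<and> length bs = p}"
      using bs unfolding blocks_def by blast
  qed
  ultimately show ?thesis by (rule rev_finite_subset)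
qed

lemma blocks_nonempty: "blocks p I \<noteq> {}"
proof -
  obtain a where "a \<in> verts A" using finite_verts(2) by blast
  then have "map (\<lambda>i. replicate (block_len I r i) a) [0..<p] \<in> blocks p I"
    by (simp add: blocks_def nlists_replicateI)
  then show ?thesis by blast
qed

lemma prob_random_tuple:
  assumes "{as \<in> nlists p (star_verts A G). P as} = glue_blocks p I ` (B \<times> choices p I)"
    and "B \<subseteq> blocks p I"
  shows "\<P>(as in measure_pmf (random_tuple p (gadget_star A G)). P as) =
    real (card B * card (choices p I)) / real (card (nlists p (star_verts A G)))"
proof -
  have "card (glue_blocks p I ` (B \<times> choices p I)) = card (B \<times> choices p I)"
    using assms(2) by (intro card_image inj_on_subset[OF inj_on_glue_blocks]) blast
  moreover have "verts (gadget_star A G) = star_verts A G"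
    by (simp add: gadget_star_def)
  moreover have "nlists p (star_verts A G) \<noteq> {}"
    using nlists_not_empty[OF finite_star_verts(2)] by blast
  ultimately show ?thesis
    unfolding random_tuple_def
    by (simp only: prob_pmf_of_set finite_nlists finite_star_verts assms(1) card_cartesian_product
        not_False_eq_True)
qed

text \<open>In the quotient on the right, the factor \<open>card (choices p I)\<close> and the
  number of all \<open>p\<close>-tuples cancel. What remains is the number of fitting blocks
  satisfying \<open>\<phi>\<close> over the number of fitting blocks. The conditional probability is
  the same ratio, once the number of all blocks cancels.\<close>

lemma profile_pairing_eq:
  fixes \<phi> :: "'s sym fm"
  assumes \<phi>: "fm_over (lang_R L r) \<phi>" "fv \<phi> \<subseteq> {..<block_off I r p}" and I: "I \<subseteq> {..<p}"
    and Es: "Es = sorted_key_list_of_set Min (classes ({..<p} - I) f)"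
    and T: "T = (\<lambda>i j. \<exists>E\<in>set Es. i \<in> E \<and> j \<in> E)"
    and pos: "\<P>(as in measure_pmf (random_tuple p (gadget_star A G)). profile A G as = (I, Es)) \<noteq> 0"
      (is "?pr \<noteq> 0")
  shows "\<P>(bs in measure_pmf (random_blocks r p (I, Es) A). respects_profile p (I, Es) A bs) > 0"
    and "profile_pairing r p (I, Es) \<phi> A = pairing p (profile_fm I T r p \<phi>) (gadget_star A G) / ?pr"
proof -
  let ?B = "{bs \<in> blocks p I. blocks_fit p I T bs}"
    and ?B\<phi> = "{bs \<in> blocks p I. blocks_fit p I T bs \<and> sat A ((!) (concat bs)) \<phi>}"
  let ?F = "real (card (nlists p (star_verts A G)))" and ?m = "real (card (choices p I))"
  let ?b = "real (card (blocks p I))"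
  have "set Es = classes ({..<p} - I) f"
    unfolding Es by (rule set_sorted_classes) simp
  then have T_iff: "T i j \<longleftrightarrow> f i = f j" if "i < p" "j < p" "i \<notin> I" "j \<notin> I" for i j
    using that in_same_class_iff[of i "{..<p} - I" j f] unfolding T by simp
  have blocks: "random_blocks r p (I, Es) A = pmf_of_set (blocks p I)"
    by (simp add: random_blocks_def blocks_def block_len_def)
  have fit: "respects_profile p (I, Es) A bs \<longleftrightarrow> blocks_fit p I T bs" for bs
    by (simp add: respects_profile_def blocks_fit_def T)
  have pr: "?pr = real (card ?B * card (choices p I)) / ?F"
    using profile_tuples[OF I T_iff] by (intro prob_random_tuple) (auto simp: Es)
  have pairing: "pairing p (profile_fm I T r p \<phi>) (gadget_star A G) =
      real (card ?B\<phi> * card (choices p I)) / ?F"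
    unfolding pairing_def
    using profile_fm_tuples[OF \<phi>] by (intro prob_random_tuple) auto
  have B: "\<P>(bs in measure_pmf (random_blocks r p (I, Es) A). respects_profile p (I, Es) A bs) =
      card ?B / ?b"
    unfolding blocks fit by (rule prob_pmf_of_set[OF finite_blocks blocks_nonempty])
  have B\<phi>: "\<P>(bs in measure_pmf (random_blocks r p (I, Es) A).
      sat A ((!) (concat bs)) \<phi> \<and> respects_profile p (I, Es) A bs) = card ?B\<phi> / ?b"
    unfolding blocks fit prob_pmf_of_set[OF finite_blocks blocks_nonempty] by (simp add: conj_commute)
  have b: "?b > 0" using finite_blocks blocks_nonempty by (simp add: card_gt_0_iff)
  \<comment> \<open>A nonzero probability of the profile supplies all the divisors;
    \<open>?F \<noteq> 0\<close> is included because division by 0 would give 0.\<close>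
  have nz: "card ?B \<noteq> 0" "?m \<noteq> 0" "?F \<noteq> 0" using pos unfolding pr by auto
  then show "\<P>(bs in measure_pmf (random_blocks r p (I, Es) A). respects_profile p (I, Es) A bs) > 0"
    unfolding B using b by simp
  have "profile_pairing r p (I, Es) \<phi> A = (card ?B\<phi> / ?b) / (card ?B / ?b)"
    unfolding profile_pairing_def cond_prob_def B B\<phi> ..
  then show "profile_pairing r p (I, Es) \<phi> A = pairing p (profile_fm I T r p \<phi>) (gadget_star A G) / ?pr"
    unfolding pr pairing using nz b by simp
qed

text \<open>The probability of a profile is itself a pairing, obtained by taking truth for
  \<open>\<phi>\<close>; this makes it accessible to the convergence hypothesis. The bounds on
  \<open>p\<close> and \<open>r\<close> ensure that the variable of \<open>Eq 0 0\<close> is a block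
  variable.\<close>

lemma prob_profile_eq_pairing:
  assumes "p \<ge> 1" "r \<ge> 1" and I: "I \<subseteq> {..<p}"
    and Es: "Es = sorted_key_list_of_set Min (classes ({..<p} - I) f)"
    and T: "T = (\<lambda>i j. \<exists>E\<in>set Es. i \<in> E \<and> j \<in> E)"
  shows "\<P>(as in measure_pmf (random_tuple p (gadget_star A G)). profile A G as = (I, Es)) =
    pairing p (profile_fm I T r p (Eq 0 0)) (gadget_star A G)"
proof -
  have "set Es = classes ({..<p} - I) f"
    unfolding Es by (rule set_sorted_classes) simp
  then have T_iff: "T i j \<longleftrightarrow> f i = f j" if "i < p" "j < p" "i \<notin> I" "j \<notin> I" for i j
    using that in_same_class_iff[of i "{..<p} - I" j f] unfolding T by simp
  have "fm_over (lang_R L r) (Eq 0 0)" "fv (Eq 0 0) \<subseteq> {..<block_off I r p}"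
    using block_off_pos[OF assms(1,2), of I] by auto
  from profile_fm_tuples[OF this, of T]
  have "{as \<in> nlists p (star_verts A G). sat (gadget_star A G) ((!) as) (profile_fm I T r p (Eq 0 0))} =
      glue_blocks p I ` ({bs \<in> blocks p I. blocks_fit p I T bs} \<times> choices p I)"
    by simp
  then show ?thesis
    unfolding pairing_def using profile_tuples[OF I T_iff]
    by (subst (1 2) prob_random_tuple[where B = "{bs \<in> blocks p I. blocks_fit p I T bs}"]) (auto simp: Es)
qed

end

section \<open>Convergence\<close>

theorem theorem6p1:
  fixes L :: "'s language" and r p :: nat
    and A :: "nat \<Rightarrow> ('s sym, 'a) struct"
    and G :: "nat \<Rightarrow> ('s, 'g) gadget"
    and I :: "nat set" and Es :: "nat set list"
    and \<phi> :: "'s sym fm"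
  assumes "\<forall>S k. L S = Some k \<longrightarrow> k \<ge> 1"
    and "r \<ge> 1"
    and "p \<ge> 1"
    and "\<forall>n. fin_struct (lang_R L r) (A n)"
    and "\<forall>n. is_gadget L r (G n)"
    and "\<forall>n. \<forall>S\<in>dom L. \<forall>vs\<in>interp (G n) S. \<not> set vs \<subseteq> set (roots (G n))"
    and "FO_loc_convergent p (lang_star L r) (\<lambda>n. gadget_star (A n) (G n))"
    and "\<not> trivial_profile p A G (I, Es)"
    and "fm_over (lang_R L r) \<phi>"
    and "local_fm (lang_R L r) \<phi>"
    and "fv \<phi> \<subseteq> {..<card I + (p - card I) * r}"
  shows "profile_pairing_converges r p (I, Es) \<phi> A"
proof -
  let ?pr = "\<lambda>n. \<P>(as in measure_pmf (random_tuple p (gadget_star (A n) (G n))).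
      profile (A n) (G n) as = (I, Es))"
  define T where "T = (\<lambda>i j. \<exists>E\<in>set Es. i \<in> E \<and> j \<in> E)"
  have loc: "base_and_gadget L r (A n) (G n)" for n
    using assms(4-6) by unfold_locales blast+
  \<comment> \<open>Nothing is assumed about the shape of \<open>(I, Es)\<close>. A single tuple
    having this profile, for some \<open>n\<close>, shows that \<open>I\<close> is a set of
    positions and that \<open>Es\<close> is a sorted list of fibres.\<close>
  have "\<exists>n. ?pr n \<noteq> 0"
  proof (rule ccontr)
    assume "\<not> ?thesis"
    then have "?pr = (\<lambda>n. 0)" by auto
    then show False using assms(8) unfolding trivial_profile_def by simp
  qed
  then obtain n where n: "?pr n \<noteq> 0" by blast
  interpret base_and_gadget L r "A n" "G n" by (rule loc)
  obtain as where as: "as \<in> nlists p (star_verts (A n) (G n))" "profile (A n) (G n) as = (I, Es)"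
  proof (rule ccontr)
    assume "\<not> thesis"
    then have "{as \<in> nlists p (star_verts (A n) (G n)). profile (A n) (G n) as = (I, Es)} = {}"
      using that by blast
    \<comment> \<open>The empty set of tuples is the image of an empty product, so the count with
      \<open>B = {}\<close> applies.\<close>
    then have "?pr n = 0"
      using prob_random_tuple[where B = "{}" and I = I and P = "\<lambda>as. profile (A n) (G n) as = (I, Es)"]
      by simp
    then show False using n by simp
  qed
  have I: "I \<subseteq> {..<p}"
    using profile_eq_classes[OF as(1) refl] as(2) by auto
  \<comment> \<open>\<open>f\<close> gives the \<rho>-images for the tuple \<open>as\<close> found
    above. Only its fibres matter, so it serves for every index and not just for this
    \<open>n\<close>.\<close>
  obtain f :: "nat \<Rightarrow> 'a list" where Es: "Es = sorted_key_list_of_set Min (classes ({..<p} - I) f)"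
    using profile_eq_classes[OF as(1) refl] as(2) by auto
  have fv: "fv \<phi> \<subseteq> {..<block_off I r p}"
    using assms(11) block_off_eq[OF I, of r] by simp
  have pr: "?pr n = pairing p (profile_fm I T r p (Eq 0 0)) (gadget_star (A n) (G n))" for n
    using base_and_gadget.prob_profile_eq_pairing[OF loc assms(3,2) I Es T_def] .
  have "local_fm (lang_R L r) (Eq 0 0)" by (simp add: local_fm_def)
  then have "profile_fm I T r p (Eq 0 0) \<in> FO_loc p (lang_star L r)"
    using block_off_pos[OF assms(3,2), of I] assms(2,3) by (intro profile_fm_in_FO_loc) auto
  then have "convergent ?pr"
    using assms(7) unfolding pr FO_loc_convergent_def by blast
  then obtain c where c: "?pr \<longlonglongrightarrow> c" unfolding convergent_def by blast
  \<comment> \<open>A limit 0 would be triviality of the profile.\<close>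
  then have "c \<noteq> 0" using assms(8) unfolding trivial_profile_def by blast
  with c have ev: "\<forall>\<^sub>F n in sequentially. ?pr n \<noteq> 0"
    by (rule tendsto_imp_eventually_ne)
  have "profile_fm I T r p \<phi> \<in> FO_loc p (lang_star L r)"
    using assms(2,3,9,10) fv by (intro profile_fm_in_FO_loc)
  then have "convergent (\<lambda>n. pairing p (profile_fm I T r p \<phi>) (gadget_star (A n) (G n)))"
    using assms(7) unfolding FO_loc_convergent_def by blast
  then obtain d where d: "(\<lambda>n. pairing p (profile_fm I T r p \<phi>) (gadget_star (A n) (G n))) \<longlonglongrightarrow> d"
    unfolding convergent_def by blast
  note eqs = base_and_gadget.profile_pairing_eq[OF loc assms(9) fv I Es T_def]
  have "(\<lambda>n. pairing p (profile_fm I T r p \<phi>) (gadget_star (A n) (G n)) / ?pr n) \<longlonglongrightarrow> d / c"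
    using d c \<open>c \<noteq> 0\<close> by (rule tendsto_divide)
  \<comment> \<open>The quotient formula needs a nonzero probability of the profile, hence holds
    only eventually.\<close>
  moreover have "\<forall>\<^sub>F n in sequentially.
      pairing p (profile_fm I T r p \<phi>) (gadget_star (A n) (G n)) / ?pr n = profile_pairing r p (I, Es) \<phi> (A n)"
    using ev by eventually_elim (simp add: eqs(2))
  ultimately have "(\<lambda>n. profile_pairing r p (I, Es) \<phi> (A n)) \<longlonglongrightarrow> d / c"
    by (rule Lim_transform_eventually)
  moreover have "\<forall>\<^sub>F n in sequentially.
      \<P>(bs in measure_pmf (random_blocks r p (I, Es) (A n)). respects_profile p (I, Es) (A n) bs) > 0"
    using ev by eventually_elim (rule eqs(1))
  ultimately show ?thesis
    unfolding profile_pairing_converges_def convergent_def by blast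
qed

end
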